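(* Let $0\longrightarrow R\longrightarrow F\stackrel{\pi}{\longrightarrow}L\longrightarrow 0$ be a free presentation of a Lie superalgebra $L$ over $\mathbb{F}$. Then $\mathrm{H}^{2}(L, \mathbb{F})\cong (F^{2}\cap R)/[F, R]$. In particular, $\mathcal{M}(L)\cong \mathrm{H}^{2}(L, \mathbb{F})$.
   Context: $\mathbb{F}$ is a field of characteristic different from $2,3$; all (super)algebras are over $\mathbb{F}$. For a homogeneous element $x$, $|x|$ denotes its $\mathbb{Z}_2$-degree; formulas containing $|x|$ are for homogeneous elements. Lie superalgebra homomorphisms are even, and ideals are $\mathbb{Z}_2$-graded. For a Lie superalgebra $G$, $G^2=[G,G]$. A free presentation of $L$ is a short exact sequence of Lie superalgebra homomorphisms $0\to R\to F\stackrel{\pi}{\to}L\to 0$ with $F$ a free Lie superalgebra; $R$ is identified with the ideal $\ker\pi$ of $F$. The Schur multiplier $\mathcal{M}(L)$ of $L$ is the factor Lie superalgebra $(F^2\cap R)/[R,F]$ for a free presentation $0\to R\to F\stackrel{\pi}{\to}L\to 0$ of $L$ (with $F$ a free Lie superalgebra and $R$ identified with the ideal $\ker\pi$ of $F$); up to isomorphism it is independent of the choice of free presentation. It is abelian, and the isomorphisms in the claim are isomorphisms of $\mathbb{Z}_2$-graded vector spaces (equivalently, of abelian Lie superalgebras). Cohomology with coefficients in the trivial $L$-module $\mathbb{F}$: $C^2(L,\mathbb{F})$ is the $\mathbb{Z}_2$-graded space of bilinear maps $f:L\times L\to\mathbb{F}$ (even and odd parts both included) with $f(x,y)=-(-1)^{|x||y|}f(y,x)$.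 $\mathrm{Z}^2(L,\mathbb{F})$ is the subspace of those $f$ with $(-1)^{|x||z|}f([x,y],z)+(-1)^{|y||x|}f([y,z],x)+(-1)^{|z||y|}f([z,x],y)=0$ for all $x,y,z\in L$. $\mathrm{B}^2(L,\mathbb{F})$ is the subspace of those $f$ of the form $f(x,y)=-\sigma([x,y])$ for some linear map $\sigma:L\to\mathbb{F}$. $\mathrm{H}^2(L,\mathbb{F})=\mathrm{Z}^2(L,\mathbb{F})/\mathrm{B}^2(L,\mathbb{F})$.
   Formalization: The claim is proved under the added hypothesis that (F²∩R)/[F,R] is finite-dimensional; without it the claim is false, since H²(L,𝔽) is the full linear dual of that space (e.g. L abelian, even, of countably infinite dimension). *)

theory Defs
  imports Complex_Main "HOL-Library.Poly_Mapping" "HOL-Library.Z2"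
    "HOL-Library.Function_Algebras" "HOL-Library.Set_Algebras"
begin

section \<open>Lie superalgebras\<close>

text \<open>A superalgebra lives on a whole type \<open>'a\<close>, whose additive structure comes from the class
  \<open>ab_group_add\<close>; the record carries the remaining structure.  Degrees are elements of the
  two-element field \<open>bit\<close>.\<close>

record ('k, 'a) superalgebra =
  scale :: "'k \<Rightarrow> 'a \<Rightarrow> 'a"
  part :: "bit \<Rightarrow> 'a set"
  bracket :: "'a \<Rightarrow> 'a \<Rightarrow> 'a"

text \<open>The Koszul sign $(-1)^{ij}$.\<close>

definition ksign :: "bit \<Rightarrow> bit \<Rightarrow> 'k::field" where
  "ksign i j = (if i = 1 \<and> j = 1 then - 1 else 1)"

locale lie_superalgebra = vector_space "scale L"
  for L :: "('k::field, 'a::ab_group_add) superalgebra" +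
  assumes subspace_part: "subspace (part L i)"
    and part_sum: "\<exists>x\<in>part L 0. \<exists>y\<in>part L 1. v = x + y"
    and part_Int: "part L 0 \<inter> part L 1 = {0}"
    and linear_bracket_left: "Vector_Spaces.linear (scale L) (scale L) (\<lambda>x. bracket L x y)"
    and linear_bracket_right: "Vector_Spaces.linear (scale L) (scale L) (\<lambda>y. bracket L x y)"
    and bracket_part: "x \<in> part L i \<Longrightarrow> y \<in> part L j \<Longrightarrow> bracket L x y \<in> part L (i + j)"
    and skew: "x \<in> part L i \<Longrightarrow> y \<in> part L j \<Longrightarrow>
      bracket L x y = - scale L (ksign i j) (bracket L y x)"
    and jacobi: "x \<in> part L i \<Longrightarrow> y \<in> part L j \<Longrightarrow> z \<in> part L k \<Longrightarrow>
      scale L (ksign i k) (bracket L (bracket L x y) z)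
      + scale L (ksign j i) (bracket L (bracket L y z) x)
      + scale L (ksign k j) (bracket L (bracket L z x) y) = 0"

definition lie_hom ::
  "('k::field, 'a::ab_group_add) superalgebra \<Rightarrow> ('k, 'b::ab_group_add) superalgebra \<Rightarrow>
    ('a \<Rightarrow> 'b) \<Rightarrow> bool" where
  "lie_hom G H h \<longleftrightarrow> Vector_Spaces.linear (scale G) (scale H) h \<and>
    (\<forall>i. h ` part G i \<subseteq> part H i) \<and>
    (\<forall>x y. h (bracket G x y) = bracket H (h x) (h y))"

text \<open>The product $[A,B]$: the linear span of all brackets $[a,b]$.\<close>

definition comm_space ::
  "('k::field, 'a::ab_group_add) superalgebra \<Rightarrow> 'a set \<Rightarrow> 'a set \<Rightarrow> 'a set" where
  "comm_space G A B = module.span (scale G) {bracket G a b | a b. a \<in> A \<and> b \<in> B}"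


section \<open>Free Lie superalgebras\<close>

text \<open>The free nonassociative algebra has as basis the nonassociative monomials; its elements are
  the finitely supported functions on monomials.  The free Lie superalgebra on a graded set \<open>X\<close>
  (with degree function \<open>d\<close>) is its quotient by the ideal generated by graded skew-symmetry and
  the graded Jacobi identity.  No further relations are needed when 2 and 3 are invertible.\<close>

datatype (gens: 'x) monomial = Gen 'x | Mul "'x monomial" "'x monomial"

type_synonym ('k, 'x) free_alg = "'x monomial \<Rightarrow>\<^sub>0 'k"

primrec mdeg :: "('x \<Rightarrow> bit) \<Rightarrow> 'x monomial \<Rightarrow> bit" where
  "mdeg d (Gen x) = d x"
| "mdeg d (Mul s t) = mdeg d s + mdeg d t"

definition fscale :: "'k::field \<Rightarrow> ('k, 'x) free_alg \<Rightarrow> ('k, 'x) free_alg" where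
  "fscale c = Poly_Mapping.map ((*) c)"

definition fmult :: "('k::field, 'x) free_alg \<Rightarrow> ('k, 'x) free_alg \<Rightarrow> ('k, 'x) free_alg" where
  "fmult p q = (\<Sum>s\<in>Poly_Mapping.keys p. \<Sum>t\<in>Poly_Mapping.keys q.
     Poly_Mapping.single (Mul s t) (Poly_Mapping.lookup p s * Poly_Mapping.lookup q t))"

definition fcarrier :: "'x set \<Rightarrow> ('k::field, 'x) free_alg set" where
  "fcarrier X = {p. \<forall>m\<in>Poly_Mapping.keys p. gens m \<subseteq> X}"

definition fpart :: "('x \<Rightarrow> bit) \<Rightarrow> 'x set \<Rightarrow> bit \<Rightarrow> ('k::field, 'x) free_alg set" where
  "fpart d X i = {p \<in> fcarrier X. \<forall>m\<in>Poly_Mapping.keys p. mdeg d m = i}"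

inductive_set lie_ideal :: "('x \<Rightarrow> bit) \<Rightarrow> 'x set \<Rightarrow> ('k::field, 'x) free_alg set"
  for d :: "'x \<Rightarrow> bit" and X :: "'x set" where
  zero: "0 \<in> lie_ideal d X"
| add: "p \<in> lie_ideal d X \<Longrightarrow> q \<in> lie_ideal d X \<Longrightarrow> p + q \<in> lie_ideal d X"
| scale: "p \<in> lie_ideal d X \<Longrightarrow> fscale c p \<in> lie_ideal d X"
| mult_left: "q \<in> fcarrier X \<Longrightarrow> p \<in> lie_ideal d X \<Longrightarrow> fmult q p \<in> lie_ideal d X"
| mult_right: "q \<in> fcarrier X \<Longrightarrow> p \<in> lie_ideal d X \<Longrightarrow> fmult p q \<in> lie_ideal d X"
| skew: "p \<in> fpart d X i \<Longrightarrow> q \<in> fpart d X j \<Longrightarrow>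
    fmult p q + fscale (ksign i j) (fmult q p) \<in> lie_ideal d X"
| jacobi: "p \<in> fpart d X i \<Longrightarrow> q \<in> fpart d X j \<Longrightarrow> r \<in> fpart d X k \<Longrightarrow>
    fscale (ksign i k) (fmult (fmult p q) r)
    + fscale (ksign j i) (fmult (fmult q r) p)
    + fscale (ksign k j) (fmult (fmult r p) q) \<in> lie_ideal d X"

primrec meval :: "('k, 'a) superalgebra \<Rightarrow> ('x \<Rightarrow> 'a) \<Rightarrow> 'x monomial \<Rightarrow> 'a" where
  "meval G h (Gen x) = h x"
| "meval G h (Mul s t) = bracket G (meval G h s) (meval G h t)"

definition feval :: "('k::field, 'a::ab_group_add) superalgebra \<Rightarrow> ('x \<Rightarrow> 'a) \<Rightarrow>
    ('k, 'x) free_alg \<Rightarrow> 'a" where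
  "feval G h p = (\<Sum>m\<in>Poly_Mapping.keys p. scale G (Poly_Mapping.lookup p m) (meval G h m))"

text \<open>\<open>G\<close> is free on its set \<open>X\<close> of homogeneous elements if evaluation of nonassociative
  polynomials induces an isomorphism from the free Lie superalgebra on \<open>X\<close> onto \<open>G\<close>.
  The universal property is lemma \<open>free_on_universal\<close> below.\<close>

definition free_on :: "('k::field, 'a::ab_group_add) superalgebra \<Rightarrow> ('a \<Rightarrow> bit) \<Rightarrow> 'a set \<Rightarrow> bool" where
  "free_on G d X \<longleftrightarrow> lie_superalgebra G \<and> (\<forall>x\<in>X. x \<in> part G (d x)) \<and>
    feval G id ` fcarrier X = UNIV \<and>
    {p \<in> fcarrier X. feval G id p = 0} = lie_ideal d X"

definition free_lie_superalgebra :: "('k::field, 'a::ab_group_add) superalgebra \<Rightarrow> bool" where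
  "free_lie_superalgebra G \<longleftrightarrow> (\<exists>d X. free_on G d X)"

lemma lookup_fscale [simp]: "Poly_Mapping.lookup (fscale c p) m = c * Poly_Mapping.lookup p m"
  by (simp add: fscale_def Poly_Mapping.map.rep_eq when_def)

lemma fcarrier_add: "p \<in> fcarrier X \<Longrightarrow> q \<in> fcarrier X \<Longrightarrow> p + q \<in> fcarrier X"
  unfolding fcarrier_def using Poly_Mapping.keys_add by fast

lemma fcarrier_scale: "p \<in> fcarrier X \<Longrightarrow> fscale c p \<in> fcarrier X"
  by (auto simp: fcarrier_def in_keys_iff)

lemma fcarrier_sum: "(\<And>i. i \<in> I \<Longrightarrow> f i \<in> fcarrier X) \<Longrightarrow> (\<Sum>i\<in>I. f i) \<in> fcarrier X"
  by (induction I rule: infinite_finite_induct) (simp_all add: fcarrier_add, simp_all add: fcarrier_def)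

lemma fcarrier_mult:
  assumes "p \<in> fcarrier X" "q \<in> fcarrier X" shows "fmult p q \<in> fcarrier X"
  unfolding fmult_def
proof (intro fcarrier_sum)
  fix s t assume "s \<in> Poly_Mapping.keys p" "t \<in> Poly_Mapping.keys q"
  thus "Poly_Mapping.single (Mul s t) (Poly_Mapping.lookup p s * Poly_Mapping.lookup q t) \<in> fcarrier X"
    using assms by (auto simp: fcarrier_def)
qed

context lie_superalgebra
begin

lemma bracket_simps:
  "bracket L (x + y) z = bracket L x z + bracket L y z"
  "bracket L x (y + z) = bracket L x y + bracket L x z"
  "bracket L (scale L c x) y = scale L c (bracket L x y)"
  "bracket L x (scale L c y) = scale L c (bracket L x y)"
  "bracket L 0 x = 0" "bracket L x 0 = 0"
proof -
  interpret l: Vector_Spaces.linear "scale L" "scale L" "\<lambda>x. bracket L x y" for y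
    by (rule linear_bracket_left)
  interpret r: Vector_Spaces.linear "scale L" "scale L" "\<lambda>y. bracket L x y" for x
    by (rule linear_bracket_right)
  show "bracket L (x + y) z = bracket L x z + bracket L y z"
    "bracket L x (y + z) = bracket L x y + bracket L x z"
    "bracket L (scale L c x) y = scale L c (bracket L x y)"
    "bracket L x (scale L c y) = scale L c (bracket L x y)"
    "bracket L 0 x = 0" "bracket L x 0 = 0"
    by (simp_all add: l.add r.add l.scale r.scale l.zero r.zero)
qed

lemma bracket_sum_left: "bracket L (\<Sum>i\<in>I. f i) x = (\<Sum>i\<in>I. bracket L (f i) x)"
  by (induction I rule: infinite_finite_induct) (simp_all add: bracket_simps)

lemma bracket_sum_right: "bracket L x (\<Sum>i\<in>I. f i) = (\<Sum>i\<in>I. bracket L x (f i))"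
  by (induction I rule: infinite_finite_induct) (simp_all add: bracket_simps)

lemma feval_superset:
  "finite K \<Longrightarrow> Poly_Mapping.keys p \<subseteq> K \<Longrightarrow>
    feval L h p = (\<Sum>m\<in>K. scale L (Poly_Mapping.lookup p m) (meval L h m))"
  unfolding feval_def by (rule sum.mono_neutral_left) (auto simp: in_keys_iff)

lemma feval_zero [simp]: "feval L h 0 = 0"
  by (simp add: feval_def)

lemma feval_add: "feval L h (p + q) = feval L h p + feval L h q"
proof -
  let ?K = "Poly_Mapping.keys p \<union> Poly_Mapping.keys q"
  have "Poly_Mapping.keys (p + q) \<subseteq> ?K" by (rule Poly_Mapping.keys_add)
  thus ?thesis
    by (simp add: feval_superset [of ?K] lookup_add scale_left_distrib sum.distrib)
qed

lemma feval_scale: "feval L h (fscale c p) = scale L c (feval L h p)"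
proof -
  have "Poly_Mapping.keys (fscale c p) \<subseteq> Poly_Mapping.keys p"
    by (auto simp: in_keys_iff)
  thus ?thesis
    by (simp add: feval_superset [of "Poly_Mapping.keys p"] scale_sum_right)
qed

lemma feval_single: "feval L h (Poly_Mapping.single m c) = scale L c (meval L h m)"
  by (simp add: feval_superset [of "{m}"])

lemma feval_sum: "feval L h (\<Sum>i\<in>I. f i) = (\<Sum>i\<in>I. feval L h (f i))"
  by (induction I rule: infinite_finite_induct) (simp_all add: feval_add)

lemma feval_mult: "feval L h (fmult p q) = bracket L (feval L h p) (feval L h q)"
proof -
  have "bracket L (feval L h p) (feval L h q) = (\<Sum>s\<in>Poly_Mapping.keys p. \<Sum>t\<in>Poly_Mapping.keys q.
     bracket L (scale L (Poly_Mapping.lookup p s) (meval L h s))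
       (scale L (Poly_Mapping.lookup q t) (meval L h t)))"
    unfolding feval_def bracket_sum_left by (simp only: bracket_sum_right)
  also have "\<dots> = feval L h (fmult p q)"
    unfolding fmult_def feval_sum feval_single by (simp add: bracket_simps mult.commute)
  finally show ?thesis by simp
qed

lemma meval_part:
  assumes h: "\<And>x. x \<in> X \<Longrightarrow> h x \<in> part L (d x)"
  shows "gens m \<subseteq> X \<Longrightarrow> meval L h m \<in> part L (mdeg d m)"
proof (induction m)
  case (Mul s t)
  thus ?case
    using bracket_part [of "meval L h s" "mdeg d s" "meval L h t" "mdeg d t"] by simp
qed (simp add: h)

lemma feval_part:
  assumes h: "\<And>x. x \<in> X \<Longrightarrow> h x \<in> part L (d x)" and p: "p \<in> fpart d X i"
  shows "feval L h p \<in> part L i"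
  unfolding feval_def
proof (rule subspace_sum [OF subspace_part])
  fix m assume m: "m \<in> Poly_Mapping.keys p"
  hence "gens m \<subseteq> X" "mdeg d m = i" using p by (auto simp: fpart_def fcarrier_def)
  thus "scale L (Poly_Mapping.lookup p m) (meval L h m) \<in> part L i"
    using meval_part [of X h d m] h subspace_scale [OF subspace_part] by metis
qed

lemma feval_lie_ideal:
  assumes h: "\<And>x. x \<in> X \<Longrightarrow> h x \<in> part L (d x)" and "p \<in> lie_ideal d X"
  shows "feval L h p = 0"
  using assms(2)
proof induction
  case (skew p i q j)
  hence "feval L h p \<in> part L i" "feval L h q \<in> part L j"
    by (simp_all add: feval_part [where d = d and X = X] h)
  from lie_superalgebra.skew [OF lie_superalgebra_axioms this] show ?case
    by (simp add: feval_add feval_scale feval_mult)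
next
  case (jacobi p i q j r k)
  hence "feval L h p \<in> part L i" "feval L h q \<in> part L j" "feval L h r \<in> part L k"
    by (simp_all add: feval_part [where d = d and X = X] h)
  from lie_superalgebra.jacobi [OF lie_superalgebra_axioms this] show ?case
    by (simp add: feval_add feval_scale feval_mult)
qed (simp_all add: feval_add feval_scale feval_mult bracket_simps)

lemma homogeneous_parts_unique:
  assumes "x \<in> part L 0" "y \<in> part L 1" "x' \<in> part L 0" "y' \<in> part L 1" "x + y = x' + y'"
  shows "x = x'" "y = y'"
proof -
  have e: "x - x' = y' - y" using assms(5) by (simp add: algebra_simps)
  have "x - x' \<in> part L 0" "y' - y \<in> part L 1"
    using assms subspace_diff [OF subspace_part] by blast+
  hence "x - x' \<in> {0}" unfolding part_Int [symmetric] using e by auto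
  thus "x = x'" "y = y'" using e by auto
qed

end

lemma lie_hom_feval:
  assumes "lie_superalgebra G" "lie_superalgebra H" "lie_hom G H \<Phi>"
  shows "\<Phi> (feval G h p) = feval H (\<lambda>x. \<Phi> (h x)) p"
proof -
  interpret l: Vector_Spaces.linear "scale G" "scale H" \<Phi>
    using assms(3) by (simp add: lie_hom_def)
  have "\<Phi> (meval G h m) = meval H (\<lambda>x. \<Phi> (h x)) m" for m
    using assms(3) by (induction m) (simp_all add: lie_hom_def)
  thus ?thesis by (simp add: feval_def l.sum l.scale)
qed

theorem free_on_universal:
  fixes F :: "('k::field, 'f::ab_group_add) superalgebra"
    and H :: "('k, 'h::ab_group_add) superalgebra"
  assumes F: "free_on F d X" and H: "lie_superalgebra H"
    and h: "\<And>x. x \<in> X \<Longrightarrow> h x \<in> part H (d x)"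
  shows "\<exists>!\<Phi>. lie_hom F H \<Phi> \<and> (\<forall>x\<in>X. \<Phi> x = h x)"
proof -
  have liF: "lie_superalgebra F" and dX: "\<And>x. x \<in> X \<Longrightarrow> id x \<in> part F (d x)"
    and img: "feval F id ` fcarrier X = UNIV"
    and ker_eq: "{p \<in> fcarrier X. feval F id p = 0} = lie_ideal d X"
    using F by (simp_all add: free_on_def)
  have surj: "\<exists>p\<in>fcarrier X. feval F id p = v" for v
    using img by (metis UNIV_I imageE)
  have ker: "p \<in> lie_ideal d X" if "p \<in> fcarrier X" "feval F id p = 0" for p
    using ker_eq that by blast
  interpret F: lie_superalgebra F by (rule liF)
  interpret H: lie_superalgebra H by (rule H)
  define \<Phi> where "\<Phi> v = feval H h (SOME p. p \<in> fcarrier X \<and> feval F id p = v)" for v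
  have \<Phi>: "\<Phi> (feval F id p) = feval H h p" if p: "p \<in> fcarrier X" for p
  proof -
    define q where "q = (SOME q. q \<in> fcarrier X \<and> feval F id q = feval F id p)"
    have q: "q \<in> fcarrier X" "feval F id q = feval F id p"
      unfolding q_def using someI [of "\<lambda>q. q \<in> fcarrier X \<and> feval F id q = feval F id p" p] p by auto
    have "feval F id (q + fscale (- 1) p) = 0"
      using q by (simp add: F.feval_add F.feval_scale)
    hence "q + fscale (- 1) p \<in> lie_ideal d X"
      using ker fcarrier_add fcarrier_scale p q by blast
    hence "feval H h (q + fscale (- 1) p) = 0" using H.feval_lie_ideal [where h = h and d = d and X = X] h by blast
    thus ?thesis unfolding \<Phi>_def q_def [symmetric] by (simp add: H.feval_add H.feval_scale)
  qed
  have "Vector_Spaces.linear (scale F) (scale H) \<Phi>"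
  proof (unfold Vector_Spaces.linear_iff, intro conjI allI)
    show "vector_space (scale F)" "vector_space (scale H)" by unfold_locales
    fix x y c
    obtain p q where pq: "p \<in> fcarrier X" "q \<in> fcarrier X" "x = feval F id p" "y = feval F id q"
      using surj by metis
    show "\<Phi> (x + y) = \<Phi> x + \<Phi> y"
      using pq \<Phi> fcarrier_add by (metis F.feval_add H.feval_add)
    show "\<Phi> (scale F c x) = scale H c (\<Phi> x)"
      using pq \<Phi> fcarrier_scale by (metis F.feval_scale H.feval_scale)
  qed
  moreover have "\<Phi> (bracket F x y) = bracket H (\<Phi> x) (\<Phi> y)" for x y
    using surj \<Phi> fcarrier_mult by (metis F.feval_mult H.feval_mult)
  moreover have "\<Phi> v \<in> part H i" if v: "v \<in> part F i" for v i
  proof -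
    obtain p where p: "p \<in> fcarrier X" "v = feval F id p" using surj by metis
    define c where "c j = (\<Sum>m\<in>{m\<in>Poly_Mapping.keys p. mdeg d m = j}.
      Poly_Mapping.single m (Poly_Mapping.lookup p m))" for j
    have lc: "Poly_Mapping.lookup (c j) m = (if mdeg d m = j then Poly_Mapping.lookup p m else 0)" for j m
      by (auto simp: c_def lookup_sum lookup_single when_def in_keys_iff)
    have cp: "c j \<in> fpart d X j" for j
      using p(1) by (auto simp: fpart_def fcarrier_def in_keys_iff lc split: if_splits)
    have pc: "p = c i + c (i + 1)" by (rule poly_mapping_eqI) (cases i; auto simp: lookup_add lc)
    let ?u = "feval F id (c i)" and ?w = "feval F id (c (i + 1))"
    have u: "?u \<in> part F i" "?w \<in> part F (i + 1)" using F.feval_part [where h = id and d = d and X = X] dX cp by blast+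
    have "?w = v - ?u" using p pc by (metis F.feval_add add_diff_cancel_left')
    hence "?w \<in> part F i" using u v F.subspace_diff [OF F.subspace_part] by simp
    hence "?w \<in> part F 0 \<inter> part F 1" using u by (cases i) auto
    hence "?w = 0" using F.part_Int by simp
    hence "v = ?u" using \<open>?w = v - ?u\<close> by simp
    hence "\<Phi> v = feval H h (c i)" using \<Phi> cp by (simp add: fpart_def)
    thus ?thesis using H.feval_part [where h = h and d = d and X = X] h cp by simp
  qed
  moreover have "\<Phi> x = h x" if "x \<in> X" for x
    using \<Phi> [of "Poly_Mapping.single (Gen x) 1"] that
    by (simp add: fcarrier_def F.feval_single H.feval_single)
  ultimately have "lie_hom F H \<Phi> \<and> (\<forall>x\<in>X. \<Phi> x = h x)"
    by (auto simp: lie_hom_def)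
  moreover have "\<Psi> = \<Phi>" if \<Psi>: "lie_hom F H \<Psi> \<and> (\<forall>x\<in>X. \<Psi> x = h x)" for \<Psi>
  proof
    fix v
    obtain p where p: "p \<in> fcarrier X" "v = feval F id p" using surj by metis
    have m: "meval H (\<lambda>x. \<Psi> (id x)) m = meval H h m" if "gens m \<subseteq> X" for m
      using that \<Psi> by (induction m) auto
    have "\<Psi> v = feval H (\<lambda>x. \<Psi> (id x)) p"
      using lie_hom_feval [OF liF H] \<Psi> p by blast
    also have "\<dots> = feval H h p"
      unfolding feval_def using p(1) m by (intro sum.cong) (auto simp: fcarrier_def)
    finally show "\<Psi> v = \<Phi> v" using \<Phi> p by simp
  qed
  ultimately show ?thesis by blast
qed

text \<open>The short exact sequence $0 \to R \to F \to L \to 0$, with \<open>R\<close> identified with the kernel.\<close>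

definition free_presentation ::
  "'a set \<Rightarrow> ('k::field, 'a::ab_group_add) superalgebra \<Rightarrow> ('a \<Rightarrow> 'b) \<Rightarrow>
    ('k, 'b::ab_group_add) superalgebra \<Rightarrow> bool" where
  "free_presentation R F \<pi> L \<longleftrightarrow> free_lie_superalgebra F \<and> lie_superalgebra L \<and>
    lie_hom F L \<pi> \<and> surj \<pi> \<and> R = {x. \<pi> x = 0}"


section \<open>Graded vector spaces and quotients\<close>

record ('k, 'v) graded_space =
  gcarrier :: "'v set"
  gadd :: "'v \<Rightarrow> 'v \<Rightarrow> 'v"
  gscale :: "'k \<Rightarrow> 'v \<Rightarrow> 'v"
  gpart :: "bit \<Rightarrow> 'v set"

definition graded_iso :: "('k, 'v) graded_space \<Rightarrow> ('k, 'w) graded_space \<Rightarrow> bool"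
    (infix \<open>\<cong>\<^sub>g\<close> 50) where
  "V \<cong>\<^sub>g W \<longleftrightarrow> (\<exists>\<phi>. bij_betw \<phi> (gcarrier V) (gcarrier W) \<and>
    (\<forall>x\<in>gcarrier V. \<forall>y\<in>gcarrier V. \<phi> (gadd V x y) = gadd W (\<phi> x) (\<phi> y)) \<and>
    (\<forall>c. \<forall>x\<in>gcarrier V. \<phi> (gscale V c x) = gscale W c (\<phi> x)) \<and>
    (\<forall>i. \<phi> ` gpart V i = gpart W i))"

text \<open>The quotient \<open>U / W\<close> of graded subspaces \<open>W \<subseteq> U\<close> of an ambient space with scalar
  multiplication \<open>s\<close> and homogeneous components \<open>P i\<close>.  Its elements are the cosets \<open>u +o W\<close>, and
  cosets are added as sets; adding \<open>W\<close> in the scalar multiplication matters only for the scalar 0.\<close>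

definition quotient_space ::
  "('k \<Rightarrow> 'v \<Rightarrow> 'v) \<Rightarrow> (bit \<Rightarrow> 'v set) \<Rightarrow> 'v::ab_group_add set \<Rightarrow> 'v set \<Rightarrow>
    ('k, 'v set) graded_space" where
  "quotient_space s P U W = \<lparr>
    gcarrier = (\<lambda>u. u +o W) ` U,
    gadd = (\<lambda>A B. A + B),
    gscale = (\<lambda>c A. s c ` A + W),
    gpart = (\<lambda>i. (\<lambda>u. u +o W) ` (U \<inter> P i))\<rparr>"

text \<open>\<open>U / W\<close> is finite-dimensional.\<close>

definition finite_dim_quotient ::
  "('k::field \<Rightarrow> 'v \<Rightarrow> 'v) \<Rightarrow> 'v::ab_group_add set \<Rightarrow> 'v set \<Rightarrow> bool" where
  "finite_dim_quotient s U W \<longleftrightarrow> (\<exists>B. finite B \<and> U \<subseteq> module.span s (B \<union> W))"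


text \<open>In particular, this finiteness holds for the multiplier of every finite-dimensional \<open>L\<close>.\<close>

lemma finite_dim_quotient_of_finite_dim:
  assumes pres: "free_presentation R F \<pi> L"
    and B: "finite B" "module.span (scale L) B = UNIV"
  shows "finite_dim_quotient (scale F) (comm_space F UNIV UNIV \<inter> R) (comm_space F UNIV R)"
proof -
  have liF: "lie_superalgebra F" and liL: "lie_superalgebra L" and hom: "lie_hom F L \<pi>"
    and surj: "surj \<pi>" and R: "R = {x. \<pi> x = 0}"
    using pres by (auto simp: free_presentation_def free_lie_superalgebra_def free_on_def)
  interpret F: lie_superalgebra F by (rule liF)
  interpret L: lie_superalgebra L by (rule liL)
  interpret p: Vector_Spaces.linear "scale F" "scale L" \<pi> using hom by (simp add: lie_hom_def)
  define C where "C = inv \<pi> ` B"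
  have "\<pi> ` C = B" unfolding C_def using surj by (simp add: image_image surj_f_inv_f)
  hence img: "\<pi> ` F.span C = UNIV" using B(2) p.span_image by metis
  have split: "\<exists>c\<in>F.span C. \<exists>r\<in>R. x = c + r" for x
  proof -
    obtain c where "c \<in> F.span C" "\<pi> c = \<pi> x" using img by (metis UNIV_I imageE)
    thus ?thesis unfolding R by (intro bexI [of _ c] bexI [of _ "x - c"]) (auto simp: p.diff)
  qed
  let ?D = "(\<lambda>(a, b). bracket F a b) ` (C \<times> C)"
  let ?K = "{bracket F a b | a b. a \<in> UNIV \<and> b \<in> R}"
  let ?S = "F.span (?D \<union> comm_space F UNIV R)"
  have KS: "bracket F a r \<in> ?S" if "r \<in> R" for a r
    using that by (intro F.span_base) (auto simp: comm_space_def intro!: F.span_base)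
  have KS': "bracket F r a \<in> ?S" if r: "r \<in> R" for a r
  proof -
    obtain r0 r1 where r01: "r0 \<in> part F 0" "r1 \<in> part F 1" "r = r0 + r1"
      using F.part_sum by metis
    obtain a0 a1 where a01: "a0 \<in> part F 0" "a1 \<in> part F 1" "a = a0 + a1"
      using F.part_sum by metis
    have in_part: "\<pi> r0 \<in> part L 0" "\<pi> r1 \<in> part L 1" using hom r01 by (auto simp: lie_hom_def)
    have "\<pi> r0 + \<pi> r1 = 0 + 0" using r r01 by (simp add: R p.add)
    hence rR: "r0 \<in> R" "r1 \<in> R"
      using L.homogeneous_parts_unique [OF in_part, of 0 0] L.subspace_0 [OF L.subspace_part]
      by (auto simp: R)
    have *: "bracket F x y \<in> ?S" if "x \<in> part F i" "y \<in> part F j" "x \<in> R" for x y i j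
      unfolding F.skew [OF that(1,2)] using KS [OF that(3)] by (intro F.span_neg F.span_scale)
    show ?thesis
      unfolding r01 a01 F.bracket_simps using * r01 a01 rR by (intro F.span_add) blast+
  qed
  have CC: "bracket F x y \<in> ?S" if "x \<in> F.span C" "y \<in> F.span C" for x y
    using that(1)
  proof (induction rule: F.span_induct_alt)
    case base show ?case by (simp add: F.bracket_simps F.span_zero)
  next
    case (step c a x)
    have "bracket F a y \<in> ?S"
      using that(2)
    proof (induction rule: F.span_induct_alt)
      case base show ?case by (simp add: F.bracket_simps F.span_zero)
    next
      case (step c b y)
      have "bracket F a b \<in> ?S" using step(1) \<open>a \<in> C\<close> by (intro F.span_base) auto
      thus ?case using step(2) by (auto simp: F.bracket_simps intro: F.span_add F.span_scale)
    qed
    thus ?case using step(2) by (auto simp: F.bracket_simps intro: F.span_add F.span_scale)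
  qed
  have "bracket F x y \<in> ?S" for x y
  proof -
    obtain c r where x: "c \<in> F.span C" "r \<in> R" "x = c + r" using split by metis
    obtain c' r' where y: "c' \<in> F.span C" "r' \<in> R" "y = c' + r'" using split by metis
    have "bracket F x y = bracket F c c' + bracket F c r' + bracket F r y"
      unfolding x y by (simp add: F.bracket_simps add.assoc)
    thus ?thesis using CC [OF x(1) y(1)] KS [OF y(2)] KS' [OF x(2)] by (simp add: F.span_add)
  qed
  hence "comm_space F UNIV UNIV \<subseteq> ?S"
    unfolding comm_space_def by (intro F.span_minimal F.subspace_span) auto
  moreover have "finite ?D" unfolding C_def using B(1) by simp
  ultimately show ?thesis unfolding finite_dim_quotient_def by blast
qed


section \<open>Schur multiplier and second cohomology\<close>

definition schur_multiplier ::
  "('k::field, 'a::ab_group_add) superalgebra \<Rightarrow> 'a set \<Rightarrow> ('k, 'a set) graded_space" where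
  "schur_multiplier F R =
    quotient_space (scale F) (part F) (comm_space F UNIV UNIV \<inter> R) (comm_space F R UNIV)"

definition C2 :: "('k::field, 'a::ab_group_add) superalgebra \<Rightarrow> ('a \<Rightarrow> 'a \<Rightarrow> 'k) set" where
  "C2 L = {f. (\<forall>x. Vector_Spaces.linear (scale L) (*) (f x)) \<and>
    (\<forall>y. Vector_Spaces.linear (scale L) (*) (\<lambda>x. f x y)) \<and>
    (\<forall>i j. \<forall>x\<in>part L i. \<forall>y\<in>part L j. f x y = - ksign i j * f y x)}"

text \<open>The field is purely even, so a form of degree \<open>i\<close> vanishes on all pairs of homogeneous
  elements whose degrees do not add up to \<open>i\<close>.\<close>

definition C2_part ::
  "('k::field, 'a::ab_group_add) superalgebra \<Rightarrow> bit \<Rightarrow> ('a \<Rightarrow> 'a \<Rightarrow> 'k) set" where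
  "C2_part L i = {f \<in> C2 L. \<forall>j k. \<forall>x\<in>part L j. \<forall>y\<in>part L k. j + k \<noteq> i \<longrightarrow> f x y = 0}"

definition Z2 :: "('k::field, 'a::ab_group_add) superalgebra \<Rightarrow> ('a \<Rightarrow> 'a \<Rightarrow> 'k) set" where
  "Z2 L = {f \<in> C2 L. \<forall>i j k. \<forall>x\<in>part L i. \<forall>y\<in>part L j. \<forall>z\<in>part L k.
    ksign i k * f (bracket L x y) z + ksign j i * f (bracket L y z) x
    + ksign k j * f (bracket L z x) y = 0}"

definition B2 :: "('k::field, 'a::ab_group_add) superalgebra \<Rightarrow> ('a \<Rightarrow> 'a \<Rightarrow> 'k) set" where
  "B2 L = {f. \<exists>\<sigma>. Vector_Spaces.linear (scale L) (*) \<sigma> \<and> f = (\<lambda>x y. - \<sigma> (bracket L x y))}"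

definition H2 ::
  "('k::field, 'a::ab_group_add) superalgebra \<Rightarrow> ('k, ('a \<Rightarrow> 'a \<Rightarrow> 'k) set) graded_space" where
  "H2 L = quotient_space (\<lambda>c f x y. c * f x y) (C2_part L) (Z2 L) (B2 L)"

end

theory Submission
  imports Defs "HOL-Library.Product_Plus"
begin

text \<open>
  A homogeneous 2-cocycle \<open>f\<close> of degree \<open>i\<close> makes \<open>L \<times> k\<close>, with \<open>k\<close> in degree \<open>i\<close>, a central
  extension of \<open>L\<close>.  Lifting \<open>\<pi>\<close> to it by freeness of \<open>F\<close> yields a functional \<open>\<tau>\<close> on \<open>F\<close> with
  \<open>\<tau> [a, b] = f (\<pi> a) (\<pi> b)\<close>.  It is unique on $F^2$, vanishes on $[F, R]$, and vanishes on
  $F^2 \cap R$ precisely if \<open>f\<close> is a coboundary; conversely, a functional that vanishes on $[F, R]$ comes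
  from a cocycle.  So $H^2(L)$ is the dual of $(F^2 \cap R)/[F, R]$.  As the latter has
  finite dimension, it has a homogeneous basis \<open>C\<close> with a dual basis, and \<open>f \<mapsto> (\<Sum>c\<in>C. \<tau> c \<cdot> c)\<close> induces
  an even isomorphism.  Finiteness passes to every other free presentation of \<open>L\<close>, to which the same
  argument then applies.
\<close>

section \<open>Linear functionals\<close>

lemma vector_space_times: "vector_space ((*) :: 'k::field \<Rightarrow> 'k \<Rightarrow> 'k)"
  by unfold_locales (simp_all add: algebra_simps)

lemma (in vector_space) functional_iff:
  "Vector_Spaces.linear scale (*) \<tau> \<longleftrightarrow>
    (\<forall>x y. \<tau> (x + y) = \<tau> x + \<tau> y) \<and> (\<forall>c x. \<tau> (scale c x) = c * \<tau> x)"
  by (simp add: Vector_Spaces.linear_iff vector_space_times vector_space_axioms)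

text \<open>A basis \<open>A\<close> of \<open>W\<close> is extended by elements of \<open>H\<close>
  to a basis \<open>D\<close> of the span of \<open>A\<close> and \<open>H\<close>. The new elements
  \<open>C\<close> are independent modulo \<open>W\<close>, so a functional that kills
  \<open>W\<close> can take any values on them. Choosing \<open>C\<close> inside \<open>H\<close>,
  which need not be a subspace, later yields a basis of homogeneous elements.\<close>

lemma (in vector_space) finite_complement:
  assumes W: "subspace W" and fin: "finite B" "H \<subseteq> span (B \<union> W)"
  obtains C where "finite C" "C \<subseteq> H" "H \<subseteq> span (C \<union> W)"
    "\<And>g. \<exists>\<tau>. Vector_Spaces.linear scale (*) \<tau> \<and> (\<forall>w\<in>W. \<tau> w = 0) \<and> (\<forall>c\<in>C. \<tau> c = g c)"
proof -
  interpret k: vector_space "(*) :: 'a \<Rightarrow> 'a \<Rightarrow> 'a" by (rule vector_space_times)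
  interpret vk: vector_space_pair scale "(*) :: 'a \<Rightarrow> 'a \<Rightarrow> 'a" ..
  interpret vv: vector_space_pair scale scale ..
  obtain A where A: "A \<subseteq> W" "independent A" "W \<subseteq> span A"
    using maximal_independent_subset by blast
  obtain D where D: "A \<subseteq> D" "D \<subseteq> A \<union> H" "independent D" "A \<union> H \<subseteq> span D"
    using maximal_independent_subset_extend [of A "A \<union> H"] A(2) by blast
  define C where "C = D - A"
  have 1: "C \<subseteq> H" using D(2) by (auto simp: C_def)
  have "D \<subseteq> C \<union> W" using A(1) by (auto simp: C_def)
  hence 2: "H \<subseteq> span (C \<union> W)" using D(4) span_mono by blast
  have 3: "\<exists>\<tau>. Vector_Spaces.linear scale (*) \<tau> \<and> (\<forall>w\<in>W. \<tau> w = 0) \<and> (\<forall>c\<in>C. \<tau> c = g c)" for g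
  proof -
    obtain \<tau> where \<tau>: "Vector_Spaces.linear scale (*) \<tau>" "\<forall>x\<in>D. \<tau> x = (if x \<in> A then 0 else g x)"
      using vk.linear_independent_extend [OF D(3), of "\<lambda>x. if x \<in> A then 0 else g x"] by blast
    have "\<tau> x = 0" if "x \<in> span A" for x
      by (rule vk.linear_eq_0_on_span [OF \<tau>(1) _ that]) (use \<tau>(2) D(1) in auto)
    thus ?thesis using \<tau> A(3) by (intro exI [of _ \<tau>]) (auto simp: C_def)
  qed
  have 4: "finite C"
  proof -
    obtain q where q: "Vector_Spaces.linear scale scale q" "\<forall>x\<in>D. q x = (if x \<in> A then 0 else x)"
      using vv.linear_independent_extend [OF D(3), of "\<lambda>x. if x \<in> A then 0 else x"] by blast
    interpret q: Vector_Spaces.linear scale scale q by (rule q(1))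
    have qW: "q x = 0" if "x \<in> W" for x
      by (rule vv.linear_eq_0_on_span [OF q(1), of A]) (use q(2) D(1) A(3) that in auto)
    have "C = q ` C" using q(2) by (force simp: C_def)
    also have "\<dots> \<subseteq> q ` span (B \<union> W)" using 1 fin(2) by blast
    also have "\<dots> = span (q ` (B \<union> W))" by (simp add: q.span_image)
    also have "\<dots> \<subseteq> span (insert 0 (q ` B))" by (rule span_mono) (auto simp: qW)
    also have "\<dots> = span (q ` B)" by simp
    finally have "C \<subseteq> span (q ` B)" .
    moreover have "independent C" using D(3) independent_mono by (auto simp: C_def)
    ultimately show ?thesis using independent_span_bound [of "q ` B" C] fin(1) by blast
  qed
  show ?thesis by (rule that [OF 4 1 2 3])
qed


section \<open>Isomorphisms of graded quotients\<close>

text \<open>A \<open>graded_space\<close> is a bare record whose operations may leave the carrier.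
  The inverse map is controlled only on the image of the carrier, so closure of \<open>V\<close> has
  to be assumed.\<close>

lemma graded_iso_sym:
  assumes "V \<cong>\<^sub>g W"
    and add: "\<And>x y. x \<in> gcarrier V \<Longrightarrow> y \<in> gcarrier V \<Longrightarrow> gadd V x y \<in> gcarrier V"
    and scale: "\<And>c x. x \<in> gcarrier V \<Longrightarrow> gscale V c x \<in> gcarrier V"
    and part: "\<And>i. gpart V i \<subseteq> gcarrier V"
  shows "W \<cong>\<^sub>g V"
proof -
  obtain \<phi> where bij: "bij_betw \<phi> (gcarrier V) (gcarrier W)"
    and \<phi>: "\<forall>x\<in>gcarrier V. \<forall>y\<in>gcarrier V. \<phi> (gadd V x y) = gadd W (\<phi> x) (\<phi> y)"
      "\<forall>c. \<forall>x\<in>gcarrier V. \<phi> (gscale V c x) = gscale W c (\<phi> x)"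
      "\<forall>i. \<phi> ` gpart V i = gpart W i"
    using assms(1) unfolding graded_iso_def by blast
  let ?\<psi> = "the_inv_into (gcarrier V) \<phi>"
  have inj: "inj_on \<phi> (gcarrier V)" and img: "\<phi> ` gcarrier V = gcarrier W"
    using bij by (simp_all add: bij_betw_def)
  have \<psi>: "?\<psi> (\<phi> x) = x" if "x \<in> gcarrier V" for x
    using the_inv_into_f_f [OF inj that] .
  have "?\<psi> (gadd W x y) = gadd V (?\<psi> x) (?\<psi> y)" if xy: "x \<in> gcarrier W" "y \<in> gcarrier W" for x y
  proof -
    obtain u v where "u \<in> gcarrier V" "v \<in> gcarrier V" "x = \<phi> u" "y = \<phi> v"
      using xy img by blast
    thus ?thesis using \<phi>(1) \<psi> add by metis
  qed
  moreover have "?\<psi> (gscale W c x) = gscale V c (?\<psi> x)" if x: "x \<in> gcarrier W" for c x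
  proof -
    obtain u where "u \<in> gcarrier V" "x = \<phi> u" using x img by blast
    thus ?thesis using \<phi>(2) \<psi> scale by metis
  qed
  moreover have "?\<psi> ` gpart W i = gpart V i" for i
  proof -
    have "?\<psi> ` gpart W i = (\<lambda>x. ?\<psi> (\<phi> x)) ` gpart V i"
      by (simp add: image_image flip: \<phi>(3) [rule_format])
    also have "\<dots> = (\<lambda>x. x) ` gpart V i" by (rule image_cong) (use \<psi> part in blast)+
    finally show ?thesis by simp
  qed
  ultimately show ?thesis
    unfolding graded_iso_def using bij_betw_the_inv_into [OF bij] by blast
qed

section \<open>Arithmetic of cosets\<close>

context vector_space
begin

lemma coset_eq_iff: "subspace W \<Longrightarrow> u +o W = v +o W \<longleftrightarrow> u - v \<in> W"
proof
  assume W: "subspace W" and "u +o W = v +o W"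
  moreover have "u \<in> u +o W" using subspace_0 [OF W] by (metis add.right_neutral set_plus_intro2)
  ultimately show "u - v \<in> W" using set_plus_imp_minus by blast
next
  assume W: "subspace W" and uv: "u - v \<in> W"
  have *: "a +o W \<subseteq> b +o W" if "a - b \<in> W" for a b
  proof
    fix x assume "x \<in> a +o W"
    then obtain w where "w \<in> W" "x = a + w" by (auto simp: elt_set_plus_def)
    hence "x - b \<in> W" using subspace_add [OF W that, of w] by (simp add: algebra_simps)
    thus "x \<in> b +o W" by (rule set_minus_imp_plus)
  qed
  have "v - u \<in> W" using subspace_neg [OF W uv] by simp
  thus "u +o W = v +o W" using * [OF uv] * [of v u] by blast
qed

lemma subspace_plus_self: "subspace W \<Longrightarrow> W + W = W"
proof
  assume W: "subspace W"
  show "W + W \<subseteq> W" using subspace_add [OF W] by (auto elim!: set_plus_elim)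
  show "W \<subseteq> W + W"
  proof
    fix w assume "w \<in> W"
    hence "0 + w \<in> W + W" using subspace_0 [OF W] by (intro set_plus_intro)
    thus "w \<in> W + W" by simp
  qed
qed

lemma coset_add: "subspace W \<Longrightarrow> (u +o W) + (v +o W) = (u + v) +o W"
  by (simp add: set_plus_rearrange subspace_plus_self)

lemma coset_scale:
  assumes W: "subspace W" shows "scale c ` (u +o W) + W = scale c u +o W"
proof
  show "scale c ` (u +o W) + W \<subseteq> scale c u +o W"
  proof
    fix x assume "x \<in> scale c ` (u +o W) + W"
    then obtain w w' where w: "w \<in> W" "w' \<in> W" "x = scale c (u + w) + w'"
      by (auto elim!: set_plus_elim simp: elt_set_plus_def)
    hence "x = scale c u + (scale c w + w')" by (simp add: scale_right_distrib add.assoc)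
    moreover have "scale c w + w' \<in> W"
      using w subspace_add [OF W] subspace_scale [OF W] by blast
    ultimately show "x \<in> scale c u +o W" by blast
  qed
  show "scale c u +o W \<subseteq> scale c ` (u +o W) + W"
  proof
    fix x assume "x \<in> scale c u +o W"
    \<comment> \<open>The representative \<open>u + 0\<close> is scaled and \<open>w\<close> is left
      to the summand \<open>W\<close>. Nothing is divided by \<open>c\<close>, so
      \<open>c = 0\<close> is covered.\<close>
    then obtain w where w: "w \<in> W" "x = scale c (u + 0) + w" by (auto simp: elt_set_plus_def)
    moreover have "u + 0 \<in> u +o W" using subspace_0 [OF W] by (rule set_plus_intro2)
    ultimately show "x \<in> scale c ` (u +o W) + W" by blast
  qed
qed

lemma quotient_space_closed:
  fixes P :: "bit \<Rightarrow> 'b set"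
  assumes U: "subspace U" and W: "subspace W"
  defines "Q \<equiv> quotient_space scale P U W"
  shows "x \<in> gcarrier Q \<Longrightarrow> y \<in> gcarrier Q \<Longrightarrow> gadd Q x y \<in> gcarrier Q"
    and "x \<in> gcarrier Q \<Longrightarrow> gscale Q c x \<in> gcarrier Q"
    and "gpart Q i \<subseteq> gcarrier Q"
  using subspace_add [OF U] subspace_scale [OF U]
  by (auto simp: Q_def quotient_space_def coset_add [OF W] coset_scale [OF W])

end

text \<open>First isomorphism theorem in terms of representatives: \<open>\<Phi>\<close> need only
  be onto modulo \<open>W'\<close>. Since \<open>P\<close> and \<open>P'\<close> are arbitrary
  families of sets, surjectivity in each degree is a separate assumption.\<close>

lemma quotient_space_iso:
  fixes s :: "'k::field \<Rightarrow> 'v::ab_group_add \<Rightarrow> 'v" and s' :: "'k \<Rightarrow> 'w::ab_group_add \<Rightarrow> 'w"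
  assumes "vector_space s" "vector_space s'"
    and U: "module.subspace s U" and W: "module.subspace s W" "W \<subseteq> U"
    and W': "module.subspace s' W'"
    and add: "\<And>u v. u \<in> U \<Longrightarrow> v \<in> U \<Longrightarrow> \<Phi> (u + v) = \<Phi> u + \<Phi> v"
    and scale: "\<And>c u. u \<in> U \<Longrightarrow> \<Phi> (s c u) = s' c (\<Phi> u)"
    and into: "\<And>u. u \<in> U \<Longrightarrow> \<Phi> u \<in> U'"
    and ker: "\<And>u. u \<in> U \<Longrightarrow> \<Phi> u \<in> W' \<longleftrightarrow> u \<in> W"
    and onto: "\<And>u'. u' \<in> U' \<Longrightarrow> \<exists>u\<in>U. u' - \<Phi> u \<in> W'"
    and part: "\<And>i u. u \<in> U \<Longrightarrow> u \<in> P i \<Longrightarrow> \<Phi> u \<in> P' i"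
    and part_onto: "\<And>i u'. u' \<in> U' \<Longrightarrow> u' \<in> P' i \<Longrightarrow> \<exists>u\<in>U \<inter> P i. u' - \<Phi> u \<in> W'"
  shows "quotient_space s P U W \<cong>\<^sub>g quotient_space s' P' U' W'"
proof -
  interpret s: vector_space s by fact
  interpret s': vector_space s' by fact
  \<comment> \<open>The union over all representatives avoids a choice. By \<open>ker\<close> all
    the cosets in the union coincide.\<close>
  define \<phi> where "\<phi> A = (\<Union>u\<in>A. \<Phi> u +o W')" for A
  have diff: "\<Phi> (u - v) = \<Phi> u - \<Phi> v" if "u \<in> U" "v \<in> U" for u v
    using add [of "u - v" v] s.subspace_diff [OF U that] that by (simp add: algebra_simps)
  have \<phi>: "\<phi> (u +o W) = \<Phi> u +o W'" if u: "u \<in> U" for u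
  proof -
    have "\<Phi> v +o W' = \<Phi> u +o W'" if "v \<in> u +o W" for v
    proof -
      have "v - u \<in> W" using that by (rule set_plus_imp_minus)
      hence "v - u \<in> U" "\<Phi> (v - u) \<in> W'" using W(2) ker by auto
      moreover from this have "v \<in> U" using s.subspace_add [OF U u, of "v - u"] by simp
      ultimately show ?thesis using diff [of v u] u by (simp add: s'.coset_eq_iff [OF W'])
    qed
    moreover have "u \<in> u +o W" using s.subspace_0 [OF W(1)] by (metis add.right_neutral set_plus_intro2)
    ultimately show ?thesis unfolding \<phi>_def by blast
  qed
  have "inj_on \<phi> ((\<lambda>u. u +o W) ` U)"
  proof (rule inj_onI, clarify)
    fix u v assume uv: "u \<in> U" "v \<in> U" "\<phi> (u +o W) = \<phi> (v +o W)"
    hence "\<Phi> (u - v) \<in> W'" by (simp add: \<phi> diff s'.coset_eq_iff [OF W'])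
    hence "u - v \<in> W" using ker s.subspace_diff [OF U] uv by simp
    thus "u +o W = v +o W" by (simp add: s.coset_eq_iff [OF W(1)])
  qed
  moreover have "\<phi> ` (\<lambda>u. u +o W) ` U = (\<lambda>u. u +o W') ` U'"
  proof
    show "\<phi> ` (\<lambda>u. u +o W) ` U \<subseteq> (\<lambda>u. u +o W') ` U'" 
    proof clarify
      fix u assume "u \<in> U"
      thus "\<phi> (u +o W) \<in> (\<lambda>u. u +o W') ` U'" using into [of u] by (simp add: \<phi>)
    qed
    show "(\<lambda>u. u +o W') ` U' \<subseteq> \<phi> ` (\<lambda>u. u +o W) ` U"
    proof clarify
      fix u' assume "u' \<in> U'"
      then obtain u where "u \<in> U" "u' - \<Phi> u \<in> W'" using onto by blast
      hence "u' +o W' = \<phi> (u +o W)" "u \<in> U" by (simp_all add: \<phi> s'.coset_eq_iff [OF W'])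
      thus "u' +o W' \<in> \<phi> ` (\<lambda>u. u +o W) ` U" by blast
    qed
  qed
  moreover have "\<phi> ` (\<lambda>u. u +o W) ` (U \<inter> P i) = (\<lambda>u. u +o W') ` (U' \<inter> P' i)" for i
  proof
    show "\<phi> ` (\<lambda>u. u +o W) ` (U \<inter> P i) \<subseteq> (\<lambda>u. u +o W') ` (U' \<inter> P' i)"
    proof clarify
      fix u assume "u \<in> U" "u \<in> P i"
      thus "\<phi> (u +o W) \<in> (\<lambda>u. u +o W') ` (U' \<inter> P' i)" using into [of u] part [of u i] by (simp add: \<phi>)
    qed
    show "(\<lambda>u. u +o W') ` (U' \<inter> P' i) \<subseteq> \<phi> ` (\<lambda>u. u +o W) ` (U \<inter> P i)"
    proof clarify
      fix u' assume "u' \<in> U'" "u' \<in> P' i"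
      then obtain u where "u \<in> U \<inter> P i" "u' - \<Phi> u \<in> W'" using part_onto by blast
      hence "u' +o W' = \<phi> (u +o W)" "u \<in> U \<inter> P i" by (simp_all add: \<phi> s'.coset_eq_iff [OF W'])
      thus "u' +o W' \<in> \<phi> ` (\<lambda>u. u +o W) ` (U \<inter> P i)" by blast
    qed
  qed
  moreover have "\<phi> (A + B) = \<phi> A + \<phi> B" if A: "A \<in> (\<lambda>u. u +o W) ` U" "B \<in> (\<lambda>u. u +o W) ` U" for A B
  proof -
    obtain u v where "u \<in> U" "v \<in> U" "A = u +o W" "B = v +o W" using A by blast
    thus ?thesis
      by (simp add: \<phi> s.coset_add [OF W(1)] s'.coset_add [OF W'] s.subspace_add [OF U] add)
  qed
  moreover have "\<phi> (s c ` A + W) = s' c ` \<phi> A + W'" if A: "A \<in> (\<lambda>u. u +o W) ` U" for A c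
  proof -
    obtain u where "u \<in> U" "A = u +o W" using A by blast
    thus ?thesis
      by (simp add: \<phi> s.coset_scale [OF W(1)] s'.coset_scale [OF W'] s.subspace_scale [OF U] scale)
  qed
  ultimately show ?thesis
    unfolding graded_iso_def quotient_space_def bij_betw_def by (intro exI [of _ \<phi>]) simp
qed


section \<open>Homogeneous components\<close>

context lie_superalgebra
begin

text \<open>In the two-element field, \<open>i + 1\<close> is the degree other than
  \<open>i\<close>, so one formula gives both projections.\<close>

definition proj :: "bit \<Rightarrow> 'a \<Rightarrow> 'a" where
  "proj i x = (THE y. y \<in> part L i \<and> x - y \<in> part L (i + 1))"

text \<open>For a subspace this says that it is the sum of its intersections with the two
  parts.\<close>

definition graded :: "'a set \<Rightarrow> bool" where
  "graded A \<longleftrightarrow> (\<forall>i. \<forall>x\<in>A. proj i x \<in> A)"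

lemma part_Int': "x \<in> part L i \<Longrightarrow> x \<in> part L (i + 1) \<Longrightarrow> x = 0"
  using part_Int by (cases i) auto

lemma proj_eqI:
  assumes y: "y \<in> part L i" "x - y \<in> part L (i + 1)" shows "proj i x = y"
  unfolding proj_def
proof (rule the_equality)
  fix z assume z: "z \<in> part L i \<and> x - z \<in> part L (i + 1)"
  have "z - y \<in> part L i" using z y subspace_diff [OF subspace_part] by blast
  moreover have "(x - y) - (x - z) \<in> part L (i + 1)"
    using z y subspace_diff [OF subspace_part] by blast
  ultimately show "z = y" using part_Int' [of "z - y"] by simp
qed (use y in simp)

lemma proj_in_part [simp]: "proj i x \<in> part L i" "x - proj i x \<in> part L (i + 1)"
proof -
  obtain a b where ab: "a \<in> part L 0" "b \<in> part L 1" "x = a + b" using part_sum by blast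
  hence "\<exists>y. y \<in> part L i \<and> x - y \<in> part L (i + 1)"
    by (cases i) (auto intro: exI [of _ a] exI [of _ b])
  hence "proj i x \<in> part L i \<and> x - proj i x \<in> part L (i + 1)" using proj_eqI by blast
  thus "proj i x \<in> part L i" "x - proj i x \<in> part L (i + 1)" by auto
qed

lemma proj_part: "x \<in> part L j \<Longrightarrow> proj i x = (if i = j then x else 0)"
proof (cases "i = j")
  case False
  assume "x \<in> part L j"
  moreover have "j = i + 1" using False by (cases i; cases j) auto
  ultimately show ?thesis using False subspace_0 [OF subspace_part] by (auto intro: proj_eqI)
qed (auto intro!: proj_eqI simp: subspace_0 [OF subspace_part])

lemma proj_sum: "proj 0 x + proj 1 x = x"
proof -
  have "x - proj 0 x \<in> part L 1" using proj_in_part(2) [of x 0] by simp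
  hence "proj 1 x = x - proj 0 x" by (rule proj_eqI) simp
  thus ?thesis by simp
qed

lemma proj_add: "proj i (x + y) = proj i x + proj i y"
proof (rule proj_eqI)
  show "proj i x + proj i y \<in> part L i" by (intro subspace_add [OF subspace_part] proj_in_part)
  have "x + y - (proj i x + proj i y) = (x - proj i x) + (y - proj i y)"
    by (rule add_diff_add)
  thus "x + y - (proj i x + proj i y) \<in> part L (i + 1)"
    by (metis subspace_add [OF subspace_part] proj_in_part(2))
qed

lemma proj_scale: "proj i (scale L c x) = scale L c (proj i x)"
proof (rule proj_eqI)
  show "scale L c (proj i x) \<in> part L i" by (intro subspace_scale [OF subspace_part] proj_in_part)
  show "scale L c x - scale L c (proj i x) \<in> part L (i + 1)"
    unfolding scale_right_diff_distrib [symmetric]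
    by (intro subspace_scale [OF subspace_part] proj_in_part)
qed

lemma linear_proj: "Vector_Spaces.linear (scale L) (scale L) (proj i)"
  by (simp add: Vector_Spaces.linear_iff vector_space_axioms proj_add proj_scale)

text \<open>Of the four brackets of components, only the two whose degrees add up to
  \<open>i\<close> survive the projection.\<close>

lemma proj_bracket:
  "proj i (bracket L x y) = bracket L (proj 0 x) (proj i y) + bracket L (proj 1 x) (proj (i + 1) y)"
proof -
  have b: "proj i (bracket L (proj j x) (proj k y)) =
      (if i = j + k then bracket L (proj j x) (proj k y) else 0)" for j k
    by (intro proj_part bracket_part proj_in_part)
  have "bracket L x y = bracket L (proj 0 x + proj 1 x) (proj 0 y + proj 1 y)"
    by (simp add: proj_sum)
  hence "proj i (bracket L x y) = proj i (bracket L (proj 0 x) (proj 0 y))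
      + proj i (bracket L (proj 0 x) (proj 1 y))
      + proj i (bracket L (proj 1 x) (proj 0 y)) + proj i (bracket L (proj 1 x) (proj 1 y))"
    by (simp add: bracket_simps proj_add add.assoc add.left_commute)
  thus ?thesis unfolding b by (cases i) simp_all
qed

lemma graded_UNIV [simp]: "graded UNIV"
  by (simp add: graded_def)

lemma graded_Int: "graded A \<Longrightarrow> graded B \<Longrightarrow> graded (A \<inter> B)"
  by (auto simp: graded_def)

lemma subspace_comm_space: "subspace (comm_space L A B)"
  by (simp add: comm_space_def)

lemma bracket_in_comm_space: "a \<in> A \<Longrightarrow> b \<in> B \<Longrightarrow> bracket L a b \<in> comm_space L A B"
  unfolding comm_space_def by (rule span_base) blast

lemma comm_space_minimal:
  assumes "subspace S" "\<And>a b. a \<in> A \<Longrightarrow> b \<in> B \<Longrightarrow> bracket L a b \<in> S"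
  shows "comm_space L A B \<subseteq> S"
  unfolding comm_space_def using assms by (intro span_minimal) auto

text \<open>The elements whose projection lies in the product form a subspace, and by
  \<open>proj_bracket\<close> it contains every generating bracket.\<close>

lemma graded_comm_space:
  assumes "graded A" "graded B" shows "graded (comm_space L A B)"
proof -
  interpret p: Vector_Spaces.linear "scale L" "scale L" "proj i" for i by (rule linear_proj)
  have "comm_space L A B \<subseteq> proj i -` comm_space L A B" for i
  proof (rule comm_space_minimal)
    show "subspace (proj i -` comm_space L A B)"
      by (rule p.subspace_vimage) (rule subspace_comm_space)
    fix a b assume "a \<in> A" "b \<in> B"
    hence "proj j a \<in> A" "proj j b \<in> B" for j using assms by (auto simp: graded_def)
    thus "bracket L a b \<in> proj i -` comm_space L A B"
      by (simp add: proj_bracket subspace_add [OF subspace_comm_space] bracket_in_comm_space)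
  qed
  thus ?thesis by (auto simp: graded_def)
qed

text \<open>Skew symmetry swaps the factors only for homogeneous elements, and gradedness keeps the
  components of \<open>a\<close> and \<open>b\<close> in \<open>A\<close> and \<open>B\<close>. This
  reconciles the two orders of the factors in the products of \<open>F\<close> with
  \<open>R\<close>.\<close>

lemma comm_space_commute:
  assumes "graded A" "graded B" shows "comm_space L A B = comm_space L B A"
proof -
  have "comm_space L A B \<subseteq> comm_space L B A" if "graded A" "graded B" for A B
  proof (rule comm_space_minimal [OF subspace_comm_space])
    fix a b assume "a \<in> A" "b \<in> B"
    hence m: "proj j a \<in> A" "proj j b \<in> B" for j using that by (auto simp: graded_def)
    have *: "bracket L (proj j a) (proj k b) \<in> comm_space L B A" for j k
      using bracket_in_comm_space [OF m(2) m(1), of k j] subspace_comm_space [of B A]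
        subspace_neg subspace_scale
      by (subst skew [OF proj_in_part(1) proj_in_part(1)]) blast
    have "bracket L a b = bracket L (proj 0 a + proj 1 a) (proj 0 b + proj 1 b)"
      by (simp add: proj_sum)
    also have "\<dots> \<in> comm_space L B A"
      unfolding bracket_simps by (intro subspace_add subspace_comm_space *)
    finally show "bracket L a b \<in> comm_space L B A" .
  qed
  thus ?thesis using assms by blast
qed

end

lemma lie_hom_proj:
  assumes "lie_superalgebra G" "lie_superalgebra H" "lie_hom G H h"
  shows "h (lie_superalgebra.proj G i x) = lie_superalgebra.proj H i (h x)"
proof -
  interpret G: lie_superalgebra G by fact
  interpret H: lie_superalgebra H by fact
  interpret h: Vector_Spaces.linear "scale G" "scale H" h using assms(3) by (simp add: lie_hom_def)
  have "h ` part G j \<subseteq> part H j" for j using assms(3) by (simp add: lie_hom_def)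
  hence "h (G.proj i x) \<in> part H i" "h (x - G.proj i x) \<in> part H (i + 1)"
    using G.proj_in_part by blast+
  thus ?thesis by (intro H.proj_eqI [symmetric]) (simp_all add: h.diff)
qed


section \<open>Cochains\<close>

context lie_superalgebra
begin

lemma C2D:
  assumes "f \<in> C2 L"
  shows "f (x + y) z = f x z + f y z" "f (scale L c x) z = c * f x z"
    "f x (y + z) = f x y + f x z" "f x (scale L c y) = c * f x y"
    "f 0 x = 0" "f x 0 = 0"
    "x \<in> part L i \<Longrightarrow> y \<in> part L j \<Longrightarrow> f x y = - ksign i j * f y x"
proof -
  interpret l: Vector_Spaces.linear "scale L" "(*)" "\<lambda>x. f x y" for y
    using assms by (simp add: C2_def)
  interpret r: Vector_Spaces.linear "scale L" "(*)" "f x" for x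
    using assms by (simp add: C2_def)
  show "f (x + y) z = f x z + f y z" "f (scale L c x) z = c * f x z"
    "f x (y + z) = f x y + f x z" "f x (scale L c y) = c * f x y"
    "f 0 x = 0" "f x 0 = 0"
    by (simp_all add: l.add l.scale r.add r.scale l.zero r.zero)
  show "x \<in> part L i \<Longrightarrow> y \<in> part L j \<Longrightarrow> f x y = - ksign i j * f y x"
    using assms unfolding C2_def by blast
qed

lemma C2I:
  assumes "\<And>x y z. f (x + y) z = f x z + f y z" "\<And>c x z. f (scale L c x) z = c * f x z"
    "\<And>x y z. f x (y + z) = f x y + f x z" "\<And>c x y. f x (scale L c y) = c * f x y"
    "\<And>i j x y. x \<in> part L i \<Longrightarrow> y \<in> part L j \<Longrightarrow> f x y = - ksign i j * f y x"
  shows "f \<in> C2 L"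
  unfolding C2_def functional_iff using assms by blast

lemma Z2_C2: "f \<in> Z2 L \<Longrightarrow> f \<in> C2 L"
  by (simp add: Z2_def)

lemma Z2D:
  "f \<in> Z2 L \<Longrightarrow> x \<in> part L i \<Longrightarrow> y \<in> part L j \<Longrightarrow> z \<in> part L k \<Longrightarrow>
    ksign i k * f (bracket L x y) z + ksign j i * f (bracket L y z) x
    + ksign k j * f (bracket L z x) y = 0"
  unfolding Z2_def by blast

lemma Z2I:
  assumes "f \<in> C2 L"
    "\<And>i j k x y z. x \<in> part L i \<Longrightarrow> y \<in> part L j \<Longrightarrow> z \<in> part L k \<Longrightarrow>
      ksign i k * f (bracket L x y) z + ksign j i * f (bracket L y z) x
      + ksign k j * f (bracket L z x) y = 0"
  shows "f \<in> Z2 L"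
  unfolding Z2_def using assms by blast

text \<open>Skew symmetry and the cocycle identity arise by applying \<open>\<sigma>\<close> to skew
  symmetry and the Jacobi identity of \<open>L\<close>.\<close>

lemma B2_subset_Z2: "B2 L \<subseteq> Z2 L"
proof
  fix f assume "f \<in> B2 L"
  then obtain \<sigma> where \<sigma>: "Vector_Spaces.linear (scale L) (*) \<sigma>"
    and f: "f = (\<lambda>x y. - \<sigma> (bracket L x y))" by (auto simp: B2_def)
  interpret \<sigma>: Vector_Spaces.linear "scale L" "(*)" \<sigma> by (rule \<sigma>)
  have sk: "f x y = - ksign i j * f y x" if "x \<in> part L i" "y \<in> part L j" for i j x y
    unfolding f using skew [OF that] by (simp add: \<sigma>.neg \<sigma>.scale)
  hence C: "f \<in> C2 L"
    by (intro C2I [OF _ _ _ _ sk]) (simp_all add: f bracket_simps \<sigma>.add \<sigma>.scale)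
  show "f \<in> Z2 L"
  proof (rule Z2I [OF C])
    fix i j k x y z
    assume "x \<in> part L i" "y \<in> part L j" "z \<in> part L k"
    from arg_cong [OF jacobi [OF this], of \<sigma>]
    show "ksign i k * f (bracket L x y) z + ksign j i * f (bracket L y z) x
        + ksign k j * f (bracket L z x) y = 0"
      by (simp add: f \<sigma>.add \<sigma>.scale \<sigma>.zero) algebra
  qed
qed

text \<open>The three pairs in the cocycle identity for homogeneous \<open>x\<close>,
  \<open>y\<close>, \<open>z\<close> have the same total degree. Discarding the values of
  \<open>f\<close> in the other total degree therefore preserves the identity.\<close>

lemma Z2_homogeneous_decomposition:
  assumes f: "f \<in> Z2 L"
  obtains g where "\<And>i. g i \<in> Z2 L \<inter> C2_part L i" "f = g 0 + g 1"
proof -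
  \<comment> \<open>\<open>g i\<close> keeps exactly the values of \<open>f\<close> on pairs whose
    degrees add up to \<open>i\<close>.\<close>
  define g where "g i x y = f (proj 0 x) (proj i y) + f (proj 1 x) (proj (i + 1) y)" for i x y
  note C = C2D [OF Z2_C2 [OF f]]
  have g: "g i x y = (if j + k = i then f x y else 0)"
    if "x \<in> part L j" "y \<in> part L k" for i j k x y
    unfolding g_def proj_part [OF that(1)] proj_part [OF that(2)]
    by (cases i; cases j; cases k) (simp_all add: C)
  have gC: "g i \<in> C2 L" for i
  proof (rule C2I)
    fix j k x y assume xy: "x \<in> part L j" "y \<in> part L k"
    show "g i x y = - ksign j k * g i y x"
      unfolding g [OF xy] g [OF xy(2,1)] add.commute [of k j] using C(7) [OF xy] by simp
  qed (simp_all add: g_def proj_add proj_scale C algebra_simps)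
  have "g i \<in> Z2 L" for i
  proof (rule Z2I [OF gC])
    fix j k l x y z
    assume m: "x \<in> part L j" "y \<in> part L k" "z \<in> part L l"
    have "(k + l) + j = (j + k) + l" "(l + j) + k = (j + k) + l"
      by (simp_all only: ac_simps)
    thus "ksign j l * g i (bracket L x y) z + ksign k j * g i (bracket L y z) x
        + ksign l k * g i (bracket L z x) y = 0"
      unfolding g [OF bracket_part [OF m(1,2)] m(3)] g [OF bracket_part [OF m(2,3)] m(1)]
        g [OF bracket_part [OF m(3,1)] m(2)]
      using Z2D [OF f m] by simp
  qed
  moreover have "g i \<in> C2_part L i" for i
    unfolding C2_part_def using gC g by auto
  moreover have "f = g 0 + g 1"
  proof (intro ext)
    fix x y
    have "f x y = f (proj 0 x + proj 1 x) (proj 0 y + proj 1 y)" by (simp add: proj_sum)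
    thus "f x y = (g 0 + g 1) x y" by (simp add: g_def C)
  qed
  ultimately show ?thesis by (intro that) auto
qed

section \<open>The central extension defined by a homogeneous cocycle\<close>

definition central_extension ::
  "bit \<Rightarrow> ('a \<Rightarrow> 'a \<Rightarrow> 'k) \<Rightarrow> ('k, 'a \<times> 'k) superalgebra" where
  "central_extension i f = \<lparr>
    scale = (\<lambda>c (x, a). (scale L c x, c * a)),
    part = (\<lambda>j. {(x, a). x \<in> part L j \<and> (j \<noteq> i \<longrightarrow> a = 0)}),
    bracket = (\<lambda>(x, a) (y, b). (bracket L x y, f x y))\<rparr>"

lemma central_extension_simps [simp]:
  "scale (central_extension i f) c (x, a) = (scale L c x, c * a)"
  "(x, a) \<in> part (central_extension i f) j \<longleftrightarrow> x \<in> part L j \<and> (j \<noteq> i \<longrightarrow> a = 0)"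
  "bracket (central_extension i f) (x, a) (y, b) = (bracket L x y, f x y)"
  by (simp_all add: central_extension_def)

text \<open>In the first coordinate the axioms are those of \<open>L\<close>. In the second, skew
  symmetry and Jacobi are the defining identities of a cocycle, and the bracket respects degrees
  because \<open>f\<close> vanishes on pairs of total degree other than \<open>i\<close>, the degree
  in which the scalars are placed.\<close>

lemma lie_superalgebra_central_extension:
  assumes f: "f \<in> Z2 L" "f \<in> C2_part L i"
  shows "lie_superalgebra (central_extension i f)" (is "lie_superalgebra ?E")
proof -
  note C = C2D [OF Z2_C2 [OF f(1)]]
  have vs: "vector_space (scale ?E)"
    by unfold_locales (auto simp: scale_right_distrib scale_left_distrib algebra_simps)
  interpret E: vector_space "scale ?E" by (rule vs)
  have Z: "f x y = 0" if "x \<in> part L j" "y \<in> part L k" "j + k \<noteq> i" for x y j k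
    using f(2) that unfolding C2_part_def by blast
  show ?thesis
  proof (intro lie_superalgebra.intro lie_superalgebra_axioms.intro vs)
    show "E.subspace (part ?E j)" for j
      by (auto simp: E.subspace_def zero_prod_def subspace_0 [OF subspace_part]
          subspace_add [OF subspace_part] subspace_scale [OF subspace_part])
    show "\<exists>x\<in>part ?E 0. \<exists>y\<in>part ?E 1. v = x + y" for v
    proof -
      obtain x a where v: "v = (x, a)" by (cases v)
      show ?thesis unfolding v
        by (rule bexI [of _ "(proj 0 x, if i = 0 then a else 0)"],
            rule bexI [of _ "(proj 1 x, if i = 1 then a else 0)"])
          (auto simp: proj_sum)
    qed
    show "part ?E 0 \<inter> part ?E 1 = {0}"
      using part_Int' [of _ 0] subspace_0 [OF subspace_part]
      by (auto simp: zero_prod_def)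
    show "Vector_Spaces.linear (scale ?E) (scale ?E) (\<lambda>x. bracket ?E x y)" for y
      by (cases y) (auto simp: Vector_Spaces.linear_iff vs bracket_simps C split_paired_all)
    show "Vector_Spaces.linear (scale ?E) (scale ?E) (\<lambda>y. bracket ?E x y)" for x
      by (cases x) (auto simp: Vector_Spaces.linear_iff vs bracket_simps C split_paired_all)
    show "bracket ?E x y \<in> part ?E (j + k)" if m: "x \<in> part ?E j" "y \<in> part ?E k" for x y j k
    proof -
      obtain a b c d where "x = (a, b)" "y = (c, d)" by (cases x, cases y)
      thus ?thesis using m Z [of a j c k] bracket_part [of a j c k] by (metis central_extension_simps(2,3))
    qed
    show "bracket ?E x y = - scale ?E (ksign j k) (bracket ?E y x)"
      if m: "x \<in> part ?E j" "y \<in> part ?E k" for x y j k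
    proof -
      obtain a b c d where xy: "x = (a, b)" "y = (c, d)" by (cases x, cases y)
      hence "a \<in> part L j" "c \<in> part L k" using m by simp_all
      from skew [OF this] C(7) [OF this] show ?thesis unfolding xy by simp
    qed
    show "scale ?E (ksign j l) (bracket ?E (bracket ?E x y) z)
        + scale ?E (ksign k j) (bracket ?E (bracket ?E y z) x)
        + scale ?E (ksign l k) (bracket ?E (bracket ?E z x) y) = 0"
      if m: "x \<in> part ?E j" "y \<in> part ?E k" "z \<in> part ?E l" for x y z j k l
    proof -
      obtain a a' b b' c c' where xyz: "x = (a, a')" "y = (b, b')" "z = (c, c')"
        by (cases x, cases y, cases z)
      hence "a \<in> part L j" "b \<in> part L k" "c \<in> part L l" using m by simp_all
      from jacobi [OF this] Z2D [OF f(1) this] show ?thesis unfolding xyz by (simp add: zero_prod_def)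
    qed
  qed
qed

end

section \<open>Linear structure of cocycles and coboundaries\<close>

lemma vector_space_forms:
  "vector_space (\<lambda>c (f :: 'a \<Rightarrow> 'a \<Rightarrow> 'k::field) x y. c * f x y)"
  by unfold_locales (auto simp: fun_eq_iff algebra_simps)

lemma (in lie_superalgebra) subspace_Z2: "module.subspace (\<lambda>c f x y. c * f x y) (Z2 L)"
proof -
  interpret forms: vector_space "\<lambda>c (f :: 'a \<Rightarrow> 'a \<Rightarrow> 'k) x y. c * f x y"
    by (rule vector_space_forms)
  note C = C2D [OF Z2_C2]
  show ?thesis
  proof (rule forms.subspaceI)
    show "0 \<in> Z2 L" by (intro Z2I C2I) simp_all
    fix f g assume f: "f \<in> Z2 L" and g: "g \<in> Z2 L"
    show "f + g \<in> Z2 L"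
    proof (intro Z2I C2I)
      fix i j x y assume xy: "x \<in> part L i" "y \<in> part L j"
      show "(f + g) x y = - ksign i j * (f + g) y x"
        using C(7) [OF f xy] C(7) [OF g xy] by (simp add: algebra_simps)
    next
      fix i j k x y z assume "x \<in> part L i" "y \<in> part L j" "z \<in> part L k"
      from Z2D [OF f this] Z2D [OF g this]
      show "ksign i k * (f + g) (bracket L x y) z + ksign j i * (f + g) (bracket L y z) x
          + ksign k j * (f + g) (bracket L z x) y = 0"
        by simp algebra
    qed (simp_all add: C [OF f] C [OF g] algebra_simps)
  next
    fix c f assume f: "f \<in> Z2 L"
    show "(\<lambda>x y. c * f x y) \<in> Z2 L"
    proof (intro Z2I C2I)
      fix i j x y assume xy: "x \<in> part L i" "y \<in> part L j"
      show "c * f x y = - ksign i j * (c * f y x)"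
        using C(7) [OF f xy] by simp
    next
      fix i j k x y z assume "x \<in> part L i" "y \<in> part L j" "z \<in> part L k"
      from Z2D [OF f this]
      show "ksign i k * (c * f (bracket L x y) z) + ksign j i * (c * f (bracket L y z) x)
          + ksign k j * (c * f (bracket L z x) y) = 0"
        by algebra
    qed (simp_all add: C [OF f] algebra_simps)
  qed
qed

lemma (in lie_superalgebra) subspace_B2: "module.subspace (\<lambda>c f x y. c * f x y) (B2 L)"
proof -
  interpret forms: vector_space "\<lambda>c (f :: 'a \<Rightarrow> 'a \<Rightarrow> 'k) x y. c * f x y"
    by (rule vector_space_forms)
  have B: "(\<lambda>x y. - \<sigma> (bracket L x y)) \<in> B2 L"
    if "\<And>x y. \<sigma> (x + y) = \<sigma> x + \<sigma> y" "\<And>c x. \<sigma> (scale L c x) = c * \<sigma> x" for \<sigma>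
    unfolding B2_def functional_iff using that by blast
  show ?thesis
  proof (rule forms.subspaceI)
    show "0 \<in> B2 L" using B [of "\<lambda>x. 0"] by (simp add: zero_fun_def)
  next
    fix f g assume "f \<in> B2 L" "g \<in> B2 L"
    then obtain \<sigma> \<rho> where "Vector_Spaces.linear (scale L) (*) \<sigma>" "f = (\<lambda>x y. - \<sigma> (bracket L x y))"
      "Vector_Spaces.linear (scale L) (*) \<rho>" "g = (\<lambda>x y. - \<rho> (bracket L x y))"
      by (auto simp: B2_def)
    thus "f + g \<in> B2 L"
      using B [of "\<lambda>x. \<sigma> x + \<rho> x"] by (simp add: functional_iff plus_fun_def algebra_simps)
  next
    fix c f assume "f \<in> B2 L"
    then obtain \<sigma> where "Vector_Spaces.linear (scale L) (*) \<sigma>" "f = (\<lambda>x y. - \<sigma> (bracket L x y))"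
      by (auto simp: B2_def)
    thus "(\<lambda>x y. c * f x y) \<in> B2 L"
      using B [of "\<lambda>x. c * \<sigma> x"] by (simp add: functional_iff algebra_simps)
  qed
qed


section \<open>Free presentations\<close>

lemma lie_hom_comp:
  assumes "lie_hom G H f" "lie_hom H K g" shows "lie_hom G K (\<lambda>x. g (f x))"
  unfolding lie_hom_def
proof (intro conjI allI)
  show "Vector_Spaces.linear (scale G) (scale K) (\<lambda>x. g (f x))"
    using assms Vector_Spaces.linear_compose [of "scale G" "scale H" f "scale K" g]
    by (simp add: lie_hom_def o_def)
  have "f ` part G i \<subseteq> part H i" "g ` part H i \<subseteq> part K i" for i
    using assms by (simp_all add: lie_hom_def)
  thus "(\<lambda>x. g (f x)) ` part G i \<subseteq> part K i" for i by fast
  show "g (f (bracket G x y)) = bracket K (g (f x)) (g (f y))" for x y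
    using assms by (simp add: lie_hom_def)
qed

locale presentation =
  fixes F :: "('k::field, 'f::ab_group_add) superalgebra"
    and L :: "('k, 'l::ab_group_add) superalgebra"
    and \<pi> :: "'f \<Rightarrow> 'l" and R :: "'f set"
  assumes presentation: "free_presentation R F \<pi> L"
begin

sublocale F: lie_superalgebra F
  using presentation by (auto simp: free_presentation_def free_lie_superalgebra_def free_on_def)

sublocale L: lie_superalgebra L
  using presentation by (simp add: free_presentation_def)

lemma lie_hom: "lie_hom F L \<pi>"
  using presentation by (simp add: free_presentation_def)

sublocale \<pi>: Vector_Spaces.linear "scale F" "scale L" \<pi>
  using lie_hom by (simp add: lie_hom_def)

abbreviation "F2 \<equiv> comm_space F UNIV UNIV"
abbreviation "FR \<equiv> comm_space F UNIV R"

lemma mem_R [simp]: "x \<in> R \<longleftrightarrow> \<pi> x = 0"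
  using presentation by (simp add: free_presentation_def)

lemma \<pi>_bracket: "\<pi> (bracket F x y) = bracket L (\<pi> x) (\<pi> y)"
  using lie_hom by (simp add: lie_hom_def)

lemma \<pi>_part: "x \<in> part F i \<Longrightarrow> \<pi> x \<in> part L i"
  using lie_hom unfolding lie_hom_def by blast

lemma \<pi>_proj: "\<pi> (F.proj i x) = L.proj i (\<pi> x)"
  by (rule lie_hom_proj [OF F.lie_superalgebra_axioms L.lie_superalgebra_axioms lie_hom])

lemma ex_preimage: "\<exists>x. \<pi> x = y"
  using presentation unfolding free_presentation_def by (metis surjD)

lemma ex_preimage_part:
  assumes "y \<in> part L i" shows "\<exists>x\<in>part F i. \<pi> x = y"
proof -
  obtain x where "\<pi> x = y" using ex_preimage by blast
  hence "\<pi> (F.proj i x) = y" using L.proj_part [OF assms] by (simp add: \<pi>_proj)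
  thus ?thesis using F.proj_in_part(1) by blast
qed

lemma subspace_R: "F.subspace R"
  by (rule F.subspaceI) (simp_all add: \<pi>.add \<pi>.scale)

lemma graded_R: "F.graded R"
  using L.proj_part [OF L.subspace_0 [OF L.subspace_part]] by (simp add: F.graded_def \<pi>_proj)

lemma FR_commute: "comm_space F R UNIV = FR"
  by (rule F.comm_space_commute [OF graded_R F.graded_UNIV])

text \<open>Free Lie superalgebras are projective. Each generator is sent to a preimage of its image
  in \<open>L\<close>, and freeness extends this to a homomorphism. Its composite with
  \<open>q\<close> agrees with \<open>\<pi>\<close> on generators, hence everywhere by uniqueness.
  Preimages of the same degree are required, as the universal property takes only maps that respect
  degrees.\<close>

lemma lift:
  fixes E :: "('k, 'e::ab_group_add) superalgebra"
  assumes E: "lie_superalgebra E" and q: "lie_hom E L q"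
    and onto: "\<And>i y. y \<in> part L i \<Longrightarrow> \<exists>x\<in>part E i. q x = y"
  obtains \<Phi> where "lie_hom F E \<Phi>" "\<And>x. q (\<Phi> x) = \<pi> x"
proof -
  obtain d X where free: "free_on F d X"
    using presentation by (auto simp: free_presentation_def free_lie_superalgebra_def)
  hence X: "\<pi> x \<in> part L (d x)" if "x \<in> X" for x
    using that \<pi>_part by (simp add: free_on_def)
  hence "\<forall>x\<in>X. \<exists>y. y \<in> part E (d x) \<and> q y = \<pi> x" using onto by blast
  then obtain h where h: "\<And>x. x \<in> X \<Longrightarrow> h x \<in> part E (d x)" "\<And>x. x \<in> X \<Longrightarrow> q (h x) = \<pi> x"
    by metis
  obtain \<Phi> where \<Phi>: "lie_hom F E \<Phi>" "\<And>x. x \<in> X \<Longrightarrow> \<Phi> x = h x"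
    using ex1_implies_ex [OF free_on_universal [OF free E h(1)]] by blast
  have "lie_hom F L (\<lambda>x. q (\<Phi> x)) \<and> (\<forall>x\<in>X. q (\<Phi> x) = \<pi> x)"
    using lie_hom_comp [OF \<Phi>(1) q] \<Phi>(2) h(2) by simp
  moreover have "lie_hom F L \<pi> \<and> (\<forall>x\<in>X. \<pi> x = \<pi> x)" using lie_hom by simp
  moreover have "\<exists>!\<Psi>. lie_hom F L \<Psi> \<and> (\<forall>x\<in>X. \<Psi> x = \<pi> x)"
    by (rule free_on_universal [OF free L.lie_superalgebra_axioms X])
  ultimately have "(\<lambda>x. q (\<Phi> x)) = \<pi>" by (elim alt_ex1E) blast
  hence "q (\<Phi> x) = \<pi> x" for x by (rule fun_cong)
  thus ?thesis using \<Phi>(1) that by blast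
qed


section \<open>Cocycles and functionals\<close>

text \<open>The functional is the second coordinate of a lift of \<open>\<pi>\<close> to the central
  extension. The lift preserves brackets, and the second coordinate of a bracket there is a value of
  \<open>f\<close>.\<close>

lemma ex_functional_homogeneous:
  assumes f: "f \<in> Z2 L" "f \<in> C2_part L i"
  shows "\<exists>\<tau>. Vector_Spaces.linear (scale F) (*) \<tau> \<and> (\<forall>a b. \<tau> (bracket F a b) = f (\<pi> a) (\<pi> b))"
proof -
  let ?E = "L.central_extension i f"
  have E: "lie_superalgebra ?E" by (rule L.lie_superalgebra_central_extension [OF f])
  interpret E: lie_superalgebra ?E by (rule E)
  have "lie_hom ?E L fst"
    by (auto simp: lie_hom_def Vector_Spaces.linear_iff E.vector_space_axioms L.vector_space_axioms)
  moreover have "\<exists>x\<in>part ?E j. fst x = y" if "y \<in> part L j" for j y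
    using that by (intro bexI [of _ "(y, 0)"]) simp_all
  ultimately obtain \<Phi> where \<Phi>: "lie_hom F ?E \<Phi>" "\<And>x. fst (\<Phi> x) = \<pi> x"
    using lift [OF E] by blast
  interpret \<Phi>: Vector_Spaces.linear "scale F" "scale ?E" \<Phi>
    using \<Phi>(1) by (simp add: lie_hom_def)
  have e: "\<Phi> x = (\<pi> x, snd (\<Phi> x))" for x using \<Phi>(2) by (metis prod.collapse)
  have "snd (\<Phi> (bracket F a b)) = f (\<pi> a) (\<pi> b)" for a b
  proof -
    have "\<Phi> (bracket F a b) = bracket ?E (\<Phi> a) (\<Phi> b)" using \<Phi>(1) by (simp add: lie_hom_def)
    also have "\<dots> = (bracket L (\<pi> a) (\<pi> b), f (\<pi> a) (\<pi> b))"
      by (subst e, subst (2) e) simp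
    finally show ?thesis by simp
  qed
  moreover have "snd (\<Phi> (scale F c x)) = c * snd (\<Phi> x)" for c x
    unfolding \<Phi>.scale by (subst e) simp
  ultimately show ?thesis
    by (intro exI [of _ "\<lambda>x. snd (\<Phi> x)"]) (simp add: F.functional_iff \<Phi>.add)
qed

text \<open>The scalars of a central extension sit in a single degree, so the two homogeneous
  components of \<open>f\<close> are treated separately and their functionals added.\<close>

lemma ex_functional:
  assumes "f \<in> Z2 L"
  shows "\<exists>\<tau>. Vector_Spaces.linear (scale F) (*) \<tau> \<and> (\<forall>a b. \<tau> (bracket F a b) = f (\<pi> a) (\<pi> b))"
proof -
  obtain g where g: "\<And>i. g i \<in> Z2 L \<inter> C2_part L i" and f: "f = g 0 + g 1"
    using L.Z2_homogeneous_decomposition [OF assms] by blast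
  have "\<exists>\<tau>. Vector_Spaces.linear (scale F) (*) \<tau> \<and> (\<forall>a b. \<tau> (bracket F a b) = g i (\<pi> a) (\<pi> b))" for i
    using ex_functional_homogeneous g by blast
  then obtain \<tau> where \<tau>: "\<And>i. Vector_Spaces.linear (scale F) (*) (\<tau> i)"
    "\<And>i a b. \<tau> i (bracket F a b) = g i (\<pi> a) (\<pi> b)" by metis
  have "Vector_Spaces.linear (scale F) (*) (\<lambda>x. \<tau> 0 x + \<tau> 1 x)"
    using \<tau>(1) by (simp add: F.functional_iff algebra_simps)
  thus ?thesis using \<tau>(2) f by (intro exI [of _ "\<lambda>x. \<tau> 0 x + \<tau> 1 x"]) simp
qed

text \<open>Since \<open>\<tau>\<close> kills \<open>FR\<close>, its value on a bracket depends only
  on the images of the two factors in \<open>L\<close>. The identities for \<open>f\<close> are then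
  those of \<open>F\<close>, evaluated by \<open>\<tau>\<close> at suitable preimages.\<close>

lemma ex_cocycle:
  assumes \<tau>: "Vector_Spaces.linear (scale F) (*) \<tau>" and FR: "\<And>x. x \<in> FR \<Longrightarrow> \<tau> x = 0"
  shows "\<exists>f\<in>Z2 L. \<forall>a b. f (\<pi> a) (\<pi> b) = \<tau> (bracket F a b)"
proof -
  interpret \<tau>: Vector_Spaces.linear "scale F" "(*)" \<tau> by (rule \<tau>)
  \<comment> \<open>A merely set-theoretic section, neither linear nor compatible with degrees. Once
    \<open>f\<close> is independent of representatives, preimages are chosen afresh for each
    identity.\<close>
  define g where "g = inv \<pi>"
  have g: "\<pi> (g y) = y" for y
    unfolding g_def using ex_preimage by (metis f_inv_into_f rangeI)
  define f where "f x y = \<tau> (bracket F (g x) (g y))" for x y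
  have f: "f (\<pi> a) (\<pi> b) = \<tau> (bracket F a b)" for a b
  proof -
    \<comment> \<open>Changing representatives by \<open>u\<close> and \<open>v\<close> in
      \<open>R\<close> changes the bracket of \<open>a\<close> and \<open>b\<close> by that of
      \<open>u\<close> with \<open>b\<close> and that of \<open>a + u\<close> with \<open>v\<close>;
      both lie in \<open>FR\<close>.\<close>
    define u v where "u = g (\<pi> a) - a" and "v = g (\<pi> b) - b"
    have "u \<in> R" "v \<in> R" by (simp_all add: u_def v_def \<pi>.diff g)
    hence "\<tau> (bracket F u b) = 0" "\<tau> (bracket F (a + u) v) = 0"
      using FR F.bracket_in_comm_space FR_commute by (metis UNIV_I)+
    moreover have "g (\<pi> a) = a + u" "g (\<pi> b) = b + v" by (simp_all add: u_def v_def)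
    ultimately show ?thesis by (simp add: f_def F.bracket_simps \<tau>.add)
  qed
  have "f \<in> Z2 L"
  proof (intro L.Z2I L.C2I)
    fix x y z c
    obtain a b e where abe: "x = \<pi> a" "y = \<pi> b" "z = \<pi> e" using ex_preimage by metis
    show "f (x + y) z = f x z + f y z" "f x (y + z) = f x y + f x z"
      unfolding abe \<pi>.add [symmetric] f by (simp_all add: F.bracket_simps \<tau>.add)
    show "f (scale L c x) z = c * f x z" "f x (scale L c y) = c * f x y"
      unfolding abe \<pi>.scale [symmetric] f by (simp_all add: F.bracket_simps \<tau>.scale)
  next
    fix i j x y assume "x \<in> part L i" "y \<in> part L j"
    then obtain a b where ab: "a \<in> part F i" "x = \<pi> a" "b \<in> part F j" "y = \<pi> b"
      using ex_preimage_part by metis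
    show "f x y = - ksign i j * f y x"
      unfolding ab f using F.skew [OF ab(1,3)] by (simp add: \<tau>.neg \<tau>.scale)
  next
    fix i j k x y z assume "x \<in> part L i" "y \<in> part L j" "z \<in> part L k"
    then obtain a b e where abe: "a \<in> part F i" "x = \<pi> a" "b \<in> part F j" "y = \<pi> b"
      "e \<in> part F k" "z = \<pi> e" using ex_preimage_part by metis
    from arg_cong [OF F.jacobi [OF abe(1,3,5)], of \<tau>]
    show "ksign i k * f (bracket L x y) z + ksign j i * f (bracket L y z) x
        + ksign k j * f (bracket L z x) y = 0"
      unfolding abe \<pi>_bracket [symmetric] f by (simp add: \<tau>.add \<tau>.scale \<tau>.zero)
  qed
  thus ?thesis using f by blast
qed

text \<open>Homogeneous arguments have homogeneous preimages. If their degrees do not add up to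
  \<open>i\<close>, the bracket of the preimages has degree \<open>i + 1\<close>, where
  \<open>\<tau>\<close> vanishes.\<close>

lemma cocycle_in_C2_part:
  assumes f: "f \<in> Z2 L" and \<tau>: "\<And>a b. f (\<pi> a) (\<pi> b) = \<tau> (bracket F a b)"
    and 0: "\<And>x. x \<in> part F (i + 1) \<Longrightarrow> \<tau> x = 0"
  shows "f \<in> C2_part L i"
  unfolding C2_part_def
proof (intro CollectI conjI allI ballI impI L.Z2_C2 [OF f])
  fix j k x y assume jk: "x \<in> part L j" "y \<in> part L k" "j + k \<noteq> i"
  then obtain a b where ab: "a \<in> part F j" "x = \<pi> a" "b \<in> part F k" "y = \<pi> b"
    using ex_preimage_part by metis
  have "j + k = i + 1" using jk(3) by (cases "j + k"; cases i) (simp_all del: add_bit_eq_xor)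
  hence "bracket F a b \<in> part F (i + 1)" using F.bracket_part [OF ab(1,3)] by simp
  thus "f x y = 0" unfolding ab \<tau> by (rule 0)
qed

text \<open>Brackets span \<open>F2\<close>. Thus the functional of a cocycle, although chosen
  arbitrarily, is determined on \<open>F2\<close> and depends linearly on the cocycle there.\<close>

lemma functional_eq_on_F2:
  assumes "Vector_Spaces.linear (scale F) (*) \<tau>" "Vector_Spaces.linear (scale F) (*) \<tau>'"
    and "\<And>a b. \<tau> (bracket F a b) = \<tau>' (bracket F a b)" and x: "x \<in> F2"
  shows "\<tau> x = \<tau>' x"
proof -
  interpret k: vector_space "(*) :: 'k \<Rightarrow> 'k \<Rightarrow> 'k" by (rule vector_space_times)
  interpret vector_space_pair "scale F" "(*) :: 'k \<Rightarrow> 'k \<Rightarrow> 'k" ..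
  show ?thesis
    by (rule linear_eq_on_span [OF assms(1,2) _ x [unfolded comm_space_def]]) (use assms(3) in auto)
qed

lemma functional_eq_0_on_FR:
  assumes "Vector_Spaces.linear (scale F) (*) \<tau>"
    and "\<And>a r. r \<in> R \<Longrightarrow> \<tau> (bracket F a r) = 0" and x: "x \<in> FR"
  shows "\<tau> x = 0"
proof -
  interpret k: vector_space "(*) :: 'k \<Rightarrow> 'k \<Rightarrow> 'k" by (rule vector_space_times)
  interpret vector_space_pair "scale F" "(*) :: 'k \<Rightarrow> 'k \<Rightarrow> 'k" ..
  show ?thesis
    by (rule linear_eq_0_on_span [OF assms(1) _ x [unfolded comm_space_def]]) (use assms(2) in auto)
qed

text \<open>If \<open>\<tau>\<close> vanishes on the kernel of \<open>\<pi>\<close> in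
  \<open>F2\<close>, it factors on \<open>F2\<close> through \<open>\<pi>\<close>, and the factor
  extends to a functional on \<open>L\<close>. Conversely, for a coboundary, \<open>\<tau>\<close>
  agrees on \<open>F2\<close> with a functional composed with \<open>\<pi>\<close>, which kills
  \<open>R\<close>.\<close>

lemma functional_eq_0_on_F2R_iff_coboundary:
  assumes f: "f \<in> Z2 L" and \<tau>: "Vector_Spaces.linear (scale F) (*) \<tau>"
    "\<And>a b. \<tau> (bracket F a b) = f (\<pi> a) (\<pi> b)"
  shows "(\<forall>x\<in>F2 \<inter> R. \<tau> x = 0) \<longleftrightarrow> f \<in> B2 L"
proof
  interpret \<tau>: Vector_Spaces.linear "scale F" "(*)" \<tau> by (rule \<tau>)
  interpret vector_space_pair "scale F" "scale L" ..
  assume 0: "\<forall>x\<in>F2 \<inter> R. \<tau> x = 0"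
  \<comment> \<open>A linear section of \<open>\<pi>\<close> over the image of \<open>F2\<close>,
    extended to all of \<open>L\<close> with values in \<open>F2\<close>. So \<open>?c\<close> and
    \<open>g (\<pi> ?c)\<close> differ by an element of \<open>F2 \<inter> R\<close>.\<close>
  obtain g where g: "range g \<subseteq> F2" "Vector_Spaces.linear (scale L) (scale F) g"
    "\<forall>v\<in>\<pi> ` F2. \<pi> (g v) = v"
    using linear_exists_right_inverse_on [OF \<pi>.linear_axioms F.subspace_comm_space] by blast
  interpret g: Vector_Spaces.linear "scale L" "scale F" g by (rule g(2))
  have "f x y = \<tau> (g (bracket L x y))" for x y
  proof -
    obtain a b where ab: "x = \<pi> a" "y = \<pi> b" using ex_preimage by metis
    let ?c = "bracket F a b"
    have c: "?c \<in> F2" by (simp add: F.bracket_in_comm_space)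
    have "g (\<pi> ?c) \<in> F2" using g(1) by blast
    hence "?c - g (\<pi> ?c) \<in> F2 \<inter> R"
      using c g(3) F.subspace_diff [OF F.subspace_comm_space] by (simp add: \<pi>.diff)
    hence "\<tau> (?c - g (\<pi> ?c)) = 0" using 0 by blast
    hence "\<tau> ?c = \<tau> (g (\<pi> ?c))" by (simp add: \<tau>.diff)
    thus ?thesis by (simp add: ab \<tau>(2) \<pi>_bracket)
  qed
  moreover have "Vector_Spaces.linear (scale L) (*) (\<lambda>x. - \<tau> (g x))"
    by (simp add: L.functional_iff g.add g.scale \<tau>.add \<tau>.scale)
  ultimately show "f \<in> B2 L"
    unfolding B2_def by (intro CollectI exI [of _ "\<lambda>x. - \<tau> (g x)"]) auto
next
  assume "f \<in> B2 L"
  then obtain \<sigma> where \<sigma>: "Vector_Spaces.linear (scale L) (*) \<sigma>"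
    and f: "f = (\<lambda>x y. - \<sigma> (bracket L x y))" by (auto simp: B2_def)
  interpret \<sigma>: Vector_Spaces.linear "scale L" "(*)" \<sigma> by (rule \<sigma>)
  have "Vector_Spaces.linear (scale F) (*) (\<lambda>x. - \<sigma> (\<pi> x))"
    by (simp add: F.functional_iff \<pi>.add \<pi>.scale \<sigma>.add \<sigma>.scale)
  hence "\<tau> x = - \<sigma> (\<pi> x)" if "x \<in> F2" for x
    using functional_eq_on_F2 [OF \<tau>(1) _ _ that] \<tau>(2) by (simp add: f \<pi>_bracket)
  thus "\<forall>x\<in>F2 \<inter> R. \<tau> x = 0" by (simp add: \<sigma>.zero)
qed


section \<open>The multiplier and the second cohomology\<close>

text \<open>Finiteness lets the quotient be identified with its dual through a basis; a homogeneous
  basis makes the identification respect degrees.\<close>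

theorem H2_iso_quotient:
  assumes fin: "finite_dim_quotient (scale F) (F2 \<inter> R) FR"
  shows "H2 L \<cong>\<^sub>g quotient_space (scale F) (part F) (F2 \<inter> R) FR"
proof -
  interpret forms: vector_space "\<lambda>c (f :: 'l \<Rightarrow> 'l \<Rightarrow> 'k) x y. c * f x y"
    by (rule vector_space_forms)
  let ?U = "F2 \<inter> R"
  have subU: "F.subspace ?U" by (intro F.subspace_inter F.subspace_comm_space subspace_R)
  have grU: "F.graded ?U" and grFR: "F.graded FR"
    by (intro F.graded_Int F.graded_comm_space F.graded_UNIV graded_R)+
  \<comment> \<open>\<open>H\<close> is not a subspace, but it spans \<open>?U\<close> because
    \<open>?U\<close> is graded. Hence \<open>C\<close> represents a homogeneous basis of the
    quotient by \<open>FR\<close>.\<close>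
  define H where "H = {x \<in> ?U. \<exists>i. x \<in> part F i}"
  obtain B where "finite B" "?U \<subseteq> F.span (B \<union> FR)"
    using fin unfolding finite_dim_quotient_def by blast
  moreover from this have "H \<subseteq> F.span (B \<union> FR)" by (auto simp: H_def)
  ultimately obtain C where C: "finite C" "C \<subseteq> H" "H \<subseteq> F.span (C \<union> FR)"
    and dual: "\<And>g. \<exists>\<tau>. Vector_Spaces.linear (scale F) (*) \<tau> \<and> (\<forall>w\<in>FR. \<tau> w = 0) \<and> (\<forall>c\<in>C. \<tau> c = g c)"
    using F.finite_complement [OF F.subspace_comm_space] by metis
  have CU: "c \<in> ?U" if "c \<in> C" for c using C(2) that by (auto simp: H_def)
  have U_decomp: "\<exists>a. \<exists>w\<in>FR. u = (\<Sum>c\<in>C. scale F (a c) c) + w" if u: "u \<in> ?U" for u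
  proof -
    have "F.proj i u \<in> H" for i
      unfolding H_def using grU u F.proj_in_part(1) unfolding F.graded_def by blast
    hence "F.proj 0 u + F.proj 1 u \<in> F.span (C \<union> FR)" using C(3) by (intro F.span_add) auto
    hence "u \<in> F.span (C \<union> FR)" by (simp add: F.proj_sum)
    then obtain x w where "x \<in> F.span C" "w \<in> F.span FR" "u = x + w"
      unfolding F.span_Un by blast
    moreover have "F.span FR = FR" by (rule F.span_eq_iff [THEN iffD2, OF F.subspace_comm_space])
    ultimately show ?thesis unfolding F.span_finite [OF C(1)] by blast
  qed
  have ext: "\<tau> u = \<tau>' u"
    if "Vector_Spaces.linear (scale F) (*) \<tau>" "Vector_Spaces.linear (scale F) (*) \<tau>'"
      and eq: "\<And>w. w \<in> FR \<Longrightarrow> \<tau> w = \<tau>' w" "\<And>c. c \<in> C \<Longrightarrow> \<tau> c = \<tau>' c" and U: "u \<in> ?U" for \<tau> \<tau>' u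
  proof -
    interpret t: Vector_Spaces.linear "scale F" "(*)" \<tau> by fact
    interpret t': Vector_Spaces.linear "scale F" "(*)" \<tau>' by fact
    obtain a w where u: "w \<in> FR" "u = (\<Sum>c\<in>C. scale F (a c) c) + w" using U_decomp [OF U] by blast
    show ?thesis
      unfolding u(2) using eq(1) [OF u(1)] eq(2)
      by (simp add: t.add t'.add t.sum t'.sum t.scale t'.scale cong: sum.cong)
  qed
  \<comment> \<open>One functional is chosen per cocycle. Nothing makes this choice linear, but
    \<open>\<tau>_eq\<close> pins it down on \<open>?U\<close>, the only place where
    \<open>\<Phi>\<close> uses it.\<close>
  obtain \<tau> where \<tau>: "\<And>f. f \<in> Z2 L \<Longrightarrow> Vector_Spaces.linear (scale F) (*) (\<tau> f)"
    "\<And>f a b. f \<in> Z2 L \<Longrightarrow> \<tau> f (bracket F a b) = f (\<pi> a) (\<pi> b)"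
    using ex_functional by metis
  have \<tau>_FR: "\<tau> f x = 0" if f: "f \<in> Z2 L" and x: "x \<in> FR" for f x
    by (rule functional_eq_0_on_FR [OF \<tau>(1) [OF f] _ x])
      (simp add: \<tau>(2) [OF f] L.C2D [OF L.Z2_C2 [OF f]])
  have \<tau>_eq: "\<tau> f x = \<sigma> x"
    if "f \<in> Z2 L" "Vector_Spaces.linear (scale F) (*) \<sigma>"
      "\<And>a b. f (\<pi> a) (\<pi> b) = \<sigma> (bracket F a b)" "x \<in> ?U" for f \<sigma> x
    by (rule functional_eq_on_F2 [OF \<tau>(1)]) (use that \<tau>(2) in auto)
  define \<Phi> where "\<Phi> f = (\<Sum>c\<in>C. scale F (\<tau> f c) c)" for f
  have \<Phi>_FR: "\<Phi> f \<in> FR \<longleftrightarrow> (\<forall>c\<in>C. \<tau> f c = 0)" for f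
  proof
    assume FR: "\<Phi> f \<in> FR"
    show "\<forall>c\<in>C. \<tau> f c = 0"
    proof
      fix d assume d: "d \<in> C"
      \<comment> \<open>\<open>t\<close> is the dual basis functional of \<open>d\<close>; it reads
        off the coefficient of \<open>d\<close> in \<open>\<Phi> f\<close>.\<close>
      obtain t where t: "Vector_Spaces.linear (scale F) (*) t" "\<forall>w\<in>FR. t w = 0"
        "\<forall>c\<in>C. t c = (if c = d then 1 else 0)"
        using dual [of "\<lambda>c. if c = d then 1 else 0"] by blast
      interpret t: Vector_Spaces.linear "scale F" "(*)" t by (rule t(1))
      have "0 = t (\<Phi> f)" using t(2) FR by simp
      also have "\<dots> = (\<Sum>c\<in>C. if c = d then \<tau> f c else 0)"
        unfolding \<Phi>_def t.sum t.scale using t(3) by (intro sum.cong) simp_all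
      also have "\<dots> = \<tau> f d" using d C(1) by simp
      finally show "\<tau> f d = 0" by simp
    qed
  next
    assume "\<forall>c\<in>C. \<tau> f c = 0"
    hence "\<Phi> f = 0" by (simp add: \<Phi>_def)
    thus "\<Phi> f \<in> FR" by (simp add: F.subspace_0 [OF F.subspace_comm_space])
  qed
  \<comment> \<open>A functional \<open>\<sigma>\<close> that kills \<open>FR\<close> belongs to a
    cocycle \<open>f\<close>, and by uniqueness \<open>\<tau> f\<close> equals
    \<open>\<sigma>\<close> on \<open>C\<close>. So \<open>\<Phi> f\<close> has the prescribed
    coefficients.\<close>
  have realize: "\<exists>f\<in>Z2 L. u - \<Phi> f \<in> FR \<and> (\<forall>a b. f (\<pi> a) (\<pi> b) = \<sigma> (bracket F a b))"
    if u: "u = (\<Sum>c\<in>C. scale F (\<sigma> c) c) + w" "w \<in> FR"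
      and \<sigma>: "Vector_Spaces.linear (scale F) (*) \<sigma>" "\<And>w. w \<in> FR \<Longrightarrow> \<sigma> w = 0" for u w \<sigma>
  proof -
    obtain f where f: "f \<in> Z2 L" "\<And>a b. f (\<pi> a) (\<pi> b) = \<sigma> (bracket F a b)"
      using ex_cocycle [OF \<sigma>] by blast
    have "\<Phi> f = (\<Sum>c\<in>C. scale F (\<sigma> c) c)"
      unfolding \<Phi>_def using \<tau>_eq [OF f(1) \<sigma>(1) f(2) CU] by (intro sum.cong) simp_all
    thus ?thesis using f u by (intro bexI [of _ f]) simp_all
  qed
  show ?thesis
    unfolding H2_def
  proof (rule quotient_space_iso [where \<Phi> = \<Phi>])
    show "vector_space (\<lambda>c (f :: 'l \<Rightarrow> 'l \<Rightarrow> 'k) x y. c * f x y)" by (rule vector_space_forms)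
    show "vector_space (scale F)" by (rule F.vector_space_axioms)
    show "forms.subspace (Z2 L)" by (rule L.subspace_Z2)
    show "forms.subspace (B2 L)" by (rule L.subspace_B2)
    show "B2 L \<subseteq> Z2 L" by (rule L.B2_subset_Z2)
    show "F.subspace FR" by (rule F.subspace_comm_space)
  next
    fix f g assume f: "f \<in> Z2 L" and g: "g \<in> Z2 L"
    have "\<tau> (f + g) c = \<tau> f c + \<tau> g c" if "c \<in> C" for c
    proof (rule \<tau>_eq [OF forms.subspace_add [OF L.subspace_Z2 f g] _ _ CU [OF that]])
      show "Vector_Spaces.linear (scale F) (*) (\<lambda>c. \<tau> f c + \<tau> g c)"
        using \<tau>(1) [OF f] \<tau>(1) [OF g] by (simp add: F.functional_iff algebra_simps)
    qed (simp add: \<tau>(2) [OF f] \<tau>(2) [OF g])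
    thus "\<Phi> (f + g) = \<Phi> f + \<Phi> g"
      by (simp add: \<Phi>_def F.scale_left_distrib sum.distrib)
  next
    fix k f assume f: "f \<in> Z2 L"
    have "\<tau> (\<lambda>x y. k * f x y) c = k * \<tau> f c" if "c \<in> C" for c
    proof (rule \<tau>_eq [OF forms.subspace_scale [OF L.subspace_Z2 f] _ _ CU [OF that]])
      show "Vector_Spaces.linear (scale F) (*) (\<lambda>c. k * \<tau> f c)"
        using \<tau>(1) [OF f] by (simp add: F.functional_iff algebra_simps)
    qed (simp add: \<tau>(2) [OF f])
    thus "\<Phi> (\<lambda>x y. k * f x y) = scale F k (\<Phi> f)"
      by (simp add: \<Phi>_def F.scale_sum_right)
  next
    fix f assume f: "f \<in> Z2 L"
    show "\<Phi> f \<in> ?U"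
      unfolding \<Phi>_def by (intro F.subspace_sum [OF subU] F.subspace_scale [OF subU] CU)
    \<comment> \<open>\<open>\<tau> f\<close> kills \<open>FR\<close>, and \<open>C\<close> spans
      \<open>?U\<close> modulo \<open>FR\<close>, so vanishing on \<open>C\<close> is the criterion
      for a coboundary.\<close>
    have "(\<forall>c\<in>C. \<tau> f c = 0) \<longleftrightarrow> (\<forall>x\<in>?U. \<tau> f x = 0)"
    proof
      assume 0: "\<forall>c\<in>C. \<tau> f c = 0"
      show "\<forall>x\<in>?U. \<tau> f x = 0"
      proof
        fix x assume x: "x \<in> ?U"
        show "\<tau> f x = 0"
          by (rule ext [OF \<tau>(1) [OF f] _ _ _ x, of "\<lambda>_. 0"])
            (use 0 \<tau>_FR [OF f] in \<open>simp_all add: F.functional_iff\<close>)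
      qed
    qed (use CU in blast)
    thus "\<Phi> f \<in> FR \<longleftrightarrow> f \<in> B2 L"
      unfolding \<Phi>_FR using functional_eq_0_on_F2R_iff_coboundary [OF f \<tau>(1) [OF f] \<tau>(2) [OF f]]
      by simp
  next
    fix u assume "u \<in> ?U"
    then obtain a w where u: "w \<in> FR" "u = (\<Sum>c\<in>C. scale F (a c) c) + w" using U_decomp by blast
    obtain \<sigma> where \<sigma>: "Vector_Spaces.linear (scale F) (*) \<sigma>" "\<forall>w\<in>FR. \<sigma> w = 0" "\<forall>c\<in>C. \<sigma> c = a c"
      using dual [of a] by blast
    have "u = (\<Sum>c\<in>C. scale F (\<sigma> c) c) + w" using u(2) \<sigma>(3) by simp
    thus "\<exists>f\<in>Z2 L. u - \<Phi> f \<in> FR" using realize [OF _ u(1) \<sigma>(1)] \<sigma>(2) by blast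
  next
    fix i f assume f: "f \<in> Z2 L" "f \<in> C2_part L i"
    have "scale F (\<tau> f c) c \<in> part F i" if c: "c \<in> C" for c
    proof -
      obtain j where j: "c \<in> part F j" using C(2) c by (auto simp: H_def)
      show ?thesis
      proof (cases "j = i")
        case True
        thus ?thesis using j F.subspace_scale [OF F.subspace_part] by blast
      next
        case False
        \<comment> \<open>Since \<open>f\<close> has degree \<open>i\<close>, it vanishes on pairs
          of total degree \<open>j\<close>. So \<open>\<tau> f\<close> after the projection to
          degree \<open>j\<close> kills all brackets, hence \<open>F2\<close>; basis elements of the
          wrong degree get coefficient 0.\<close>
        have "\<tau> f (F.proj j c) = 0"
        proof (rule functional_eq_on_F2 [where \<tau> = "\<lambda>x. \<tau> f (F.proj j x)" and \<tau>' = "\<lambda>_. 0"])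
          show "Vector_Spaces.linear (scale F) (*) (\<lambda>x. \<tau> f (F.proj j x))"
            using \<tau>(1) [OF f(1)] by (simp add: F.functional_iff F.proj_add F.proj_scale)
          have t: "\<tau> f (x + y) = \<tau> f x + \<tau> f y" for x y
            using \<tau>(1) [OF f(1)] by (simp add: F.functional_iff)
          have 0: "f (\<pi> x) (\<pi> y) = 0" if "x \<in> part F k" "y \<in> part F l" "k + l = j" for x y k l
            using f(2) \<pi>_part [OF that(1)] \<pi>_part [OF that(2)] that(3) False
            unfolding C2_part_def by blast
          show "\<tau> f (F.proj j (bracket F a b)) = 0" for a b
            unfolding F.proj_bracket t \<tau>(2) [OF f(1)]
            using 0 [of "F.proj 0 a" 0 "F.proj j b" j] 0 [of "F.proj 1 a" 1 "F.proj (j + 1) b" "j + 1"]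
            by (cases j) simp_all
          show "c \<in> F2" using CU [OF c] by simp
        qed (simp add: F.functional_iff)
        thus ?thesis using F.subspace_0 [OF F.subspace_part] by (simp add: F.proj_part [OF j])
      qed
    qed
    thus "\<Phi> f \<in> part F i" unfolding \<Phi>_def by (intro F.subspace_sum [OF F.subspace_part])
  next
    fix i u assume u: "u \<in> ?U" "u \<in> part F i"
    then obtain a w where aw: "w \<in> FR" "u = (\<Sum>c\<in>C. scale F (a c) c) + w" using U_decomp by blast
    interpret p: Vector_Spaces.linear "scale F" "scale F" "F.proj i" by (rule F.linear_proj)
    define b where "b c = (if c \<in> part F i then a c else 0)" for c
    have pc: "F.proj i c = (if c \<in> part F i then c else 0)" if c: "c \<in> C" for c
    proof -
      obtain j where j: "c \<in> part F j" using C(2) c by (auto simp: H_def)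
      show ?thesis
      proof (cases "c \<in> part F i")
        case True
        thus ?thesis using F.proj_part [OF True, of i] by simp
      next
        case False
        thus ?thesis using F.proj_part [OF j, of i] j by auto
      qed
    qed
    have "u = F.proj i u" using F.proj_part [OF u(2), of i] by simp
    also have "\<dots> = (\<Sum>c\<in>C. scale F (a c) (F.proj i c)) + F.proj i w"
      unfolding aw(2) p.add p.sum p.scale ..
    also have "(\<Sum>c\<in>C. scale F (a c) (F.proj i c)) = (\<Sum>c\<in>C. scale F (b c) c)"
      by (rule sum.cong) (simp_all add: pc b_def)
    finally have ub: "u = (\<Sum>c\<in>C. scale F (b c) c) + F.proj i w" .
    have pw: "F.proj i w \<in> FR" using grFR aw(1) by (auto simp: F.graded_def)
    obtain \<sigma> where \<sigma>: "Vector_Spaces.linear (scale F) (*) \<sigma>" "\<forall>w\<in>FR. \<sigma> w = 0" "\<forall>c\<in>C. \<sigma> c = b c"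
      using dual [of b] by blast
    interpret \<sigma>: Vector_Spaces.linear "scale F" "(*)" \<sigma> by (rule \<sigma>(1))
    \<comment> \<open>Composition with the projection makes the functional vanish in degree
      \<open>i + 1\<close>, so the cocycle that realizes it has degree \<open>i\<close>.\<close>
    let ?\<sigma> = "\<lambda>x. \<sigma> (F.proj i x)"
    have "\<sigma> (F.proj i c) = b c" if "c \<in> C" for c
      using \<sigma>(3) that by (simp add: pc [OF that] b_def \<sigma>.zero)
    hence "u = (\<Sum>c\<in>C. scale F (?\<sigma> c) c) + F.proj i w" using ub by simp
    moreover have "Vector_Spaces.linear (scale F) (*) ?\<sigma>"
      by (simp add: F.functional_iff p.add p.scale \<sigma>.add \<sigma>.scale)
    moreover have "?\<sigma> w = 0" if "w \<in> FR" for w using grFR that \<sigma>(2) by (auto simp: F.graded_def)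
    ultimately obtain f where f: "f \<in> Z2 L" "u - \<Phi> f \<in> FR"
      "\<And>a b. f (\<pi> a) (\<pi> b) = ?\<sigma> (bracket F a b)"
      using realize [OF _ pw] by blast
    have "?\<sigma> x = 0" if "x \<in> part F (i + 1)" for x
      using F.proj_part [OF that, of i] by (simp add: \<sigma>.zero)
    hence "f \<in> C2_part L i" by (rule cocycle_in_C2_part [OF f(1,3)])
    thus "\<exists>f\<in>Z2 L \<inter> C2_part L i. u - \<Phi> f \<in> FR" using f by blast
  qed
qed

end

section \<open>Comparison of two free presentations\<close>

text \<open>The composite \<open>G \<rightarrow> F \<rightarrow> G\<close> of two lifts of the identity of \<open>L\<close> differs from the identity by
  a map that sends \<open>[G, G]\<close> into \<open>[G, S]\<close>.\<close>

lemma finite_dim_quotient_transfer: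
  assumes F: "presentation F L \<pi> R" and G: "presentation G L \<rho> S"
    and fin: "finite_dim_quotient (scale F) (comm_space F UNIV UNIV \<inter> R) (comm_space F UNIV R)"
  shows "finite_dim_quotient (scale G) (comm_space G UNIV UNIV \<inter> S) (comm_space G UNIV S)"
proof -
  interpret f: presentation F L \<pi> R by (rule F)
  interpret g: presentation G L \<rho> S by (rule G)
  obtain \<alpha> where \<alpha>: "lie_hom G F \<alpha>" "\<And>x. \<pi> (\<alpha> x) = \<rho> x"
    using g.lift [OF f.F.lie_superalgebra_axioms f.lie_hom f.ex_preimage_part] by blast
  obtain \<beta> where \<beta>: "lie_hom F G \<beta>" "\<And>x. \<rho> (\<beta> x) = \<pi> x"
    using f.lift [OF g.F.lie_superalgebra_axioms g.lie_hom g.ex_preimage_part] by blast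
  interpret \<alpha>: Vector_Spaces.linear "scale G" "scale F" \<alpha> using \<alpha>(1) by (simp add: lie_hom_def)
  interpret \<beta>: Vector_Spaces.linear "scale F" "scale G" \<beta> using \<beta>(1) by (simp add: lie_hom_def)
  have br: "\<alpha> (bracket G a b) = bracket F (\<alpha> a) (\<alpha> b)" "\<beta> (bracket F x y) = bracket G (\<beta> x) (\<beta> y)"
    for a b x y using \<alpha>(1) \<beta>(1) by (simp_all add: lie_hom_def)
  note GS = g.F.subspace_comm_space [of UNIV S]
  \<comment> \<open>Both lifts cover the identity of \<open>L\<close>, so \<open>\<delta>\<close>
    takes values in \<open>S\<close>. Expanding the bracket of \<open>a + \<delta> a\<close> and
    \<open>b + \<delta> b\<close> then leaves only terms in \<open>g.FR\<close> besides the bracket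
    of \<open>a\<close> and \<open>b\<close>.\<close>
  define \<delta> where "\<delta> x = \<beta> (\<alpha> x) - x" for x
  have "g.F2 \<subseteq> {x. \<delta> x \<in> g.FR}"
  proof (rule g.F.comm_space_minimal)
    show "g.F.subspace {x. \<delta> x \<in> g.FR}"
    proof (rule g.F.subspaceI)
      show "0 \<in> {x. \<delta> x \<in> g.FR}"
        using g.F.subspace_0 [OF GS] by (simp add: \<delta>_def \<alpha>.zero \<beta>.zero)
    next
      fix x y assume "x \<in> {x. \<delta> x \<in> g.FR}" "y \<in> {x. \<delta> x \<in> g.FR}"
      moreover have "\<delta> (x + y) = \<delta> x + \<delta> y" by (simp add: \<delta>_def \<alpha>.add \<beta>.add)
      ultimately show "x + y \<in> {x. \<delta> x \<in> g.FR}" using g.F.subspace_add [OF GS] by simp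
    next
      fix c x assume "x \<in> {x. \<delta> x \<in> g.FR}"
      moreover have "\<delta> (scale G c x) = scale G c (\<delta> x)"
        by (simp add: \<delta>_def \<alpha>.scale \<beta>.scale g.F.scale_right_diff_distrib)
      ultimately show "scale G c x \<in> {x. \<delta> x \<in> g.FR}" using g.F.subspace_scale [OF GS] by simp
    qed
    fix a b
    have ab: "\<delta> a \<in> S" "\<delta> b \<in> S" by (simp_all add: \<delta>_def g.\<pi>.diff \<alpha>(2) \<beta>(2))
    have \<beta>\<alpha>: "\<beta> (\<alpha> x) = x + \<delta> x" for x by (simp add: \<delta>_def)
    have "\<delta> (bracket G a b) = bracket G (a + \<delta> a) (b + \<delta> b) - bracket G a b"
      by (simp only: \<delta>_def [of "bracket G a b"] br \<beta>\<alpha>)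
    also have "\<dots> = bracket G (a + \<delta> a) (\<delta> b) + bracket G (\<delta> a) b"
      by (simp add: g.F.bracket_simps)
    also have "\<dots> \<in> g.FR"
    proof (rule g.F.subspace_add [OF GS])
      show "bracket G (a + \<delta> a) (\<delta> b) \<in> g.FR" by (rule g.F.bracket_in_comm_space [OF UNIV_I ab(2)])
      show "bracket G (\<delta> a) b \<in> g.FR"
        unfolding g.FR_commute [symmetric] by (rule g.F.bracket_in_comm_space [OF ab(1) UNIV_I])
    qed
    finally show "bracket G a b \<in> {x. \<delta> x \<in> g.FR}" by simp
  qed
  hence \<delta>: "\<delta> x \<in> g.FR" if "x \<in> g.F2" for x using that by blast
  have "g.F2 \<subseteq> \<alpha> -` f.F2"
    by (rule g.F.comm_space_minimal [OF \<alpha>.subspace_vimage [OF f.F.subspace_comm_space]])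
      (simp add: br f.F.bracket_in_comm_space)
  hence \<alpha>_F2: "\<alpha> x \<in> f.F2" if "x \<in> g.F2" for x using that by blast
  have "f.FR \<subseteq> \<beta> -` g.FR"
    by (rule f.F.comm_space_minimal [OF \<beta>.subspace_vimage [OF GS]])
      (simp add: br g.F.bracket_in_comm_space \<beta>(2))
  hence \<beta>_FR: "\<beta> ` f.FR \<subseteq> g.FR" by blast
  obtain B where B: "finite B" "f.F2 \<inter> R \<subseteq> f.F.span (B \<union> f.FR)"
    using fin unfolding finite_dim_quotient_def by blast
  \<comment> \<open>Each \<open>x\<close> here is \<open>\<beta> (\<alpha> x) - \<delta> x\<close>:
    the first term comes from the span in \<open>F\<close>, the second lies in
    \<open>g.FR\<close>.\<close>
  have "g.F2 \<inter> S \<subseteq> g.F.span (\<beta> ` B \<union> g.FR)"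
  proof
    fix x assume x: "x \<in> g.F2 \<inter> S"
    hence "\<alpha> x \<in> f.F2 \<inter> R" using \<alpha>_F2 \<alpha>(2) by simp
    hence "\<beta> (\<alpha> x) \<in> \<beta> ` f.F.span (B \<union> f.FR)" using B(2) by blast
    also have "\<dots> = g.F.span (\<beta> ` (B \<union> f.FR))" by (simp add: \<beta>.span_image)
    also have "\<dots> \<subseteq> g.F.span (\<beta> ` B \<union> g.FR)" using \<beta>_FR by (intro g.F.span_mono) blast
    finally have "\<beta> (\<alpha> x) \<in> g.F.span (\<beta> ` B \<union> g.FR)" .
    moreover have "\<delta> x \<in> g.F.span (\<beta> ` B \<union> g.FR)" using \<delta> x by (intro g.F.span_base) blast
    ultimately have "\<beta> (\<alpha> x) - \<delta> x \<in> g.F.span (\<beta> ` B \<union> g.FR)" by (rule g.F.span_diff)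
    thus "x \<in> g.F.span (\<beta> ` B \<union> g.FR)" by (simp add: \<delta>_def)
  qed
  thus ?thesis unfolding finite_dim_quotient_def using B(1) by blast
qed

theorem theorem8:
  fixes F :: "('k::field, 'f::ab_group_add) superalgebra"
    and L :: "('k, 'l::ab_group_add) superalgebra"
    and \<pi> :: "'f \<Rightarrow> 'l" and R :: "'f set"
  assumes "CHAR('k) \<noteq> 2" and "CHAR('k) \<noteq> 3"
    and "free_presentation R F \<pi> L"
    and "finite_dim_quotient (scale F) (comm_space F UNIV UNIV \<inter> R) (comm_space F UNIV R)"
  shows "H2 L \<cong>\<^sub>g quotient_space (scale F) (part F)
            (comm_space F UNIV UNIV \<inter> R) (comm_space F UNIV R)
         \<and> (\<forall>(G :: ('k, 'g::ab_group_add) superalgebra) \<rho> S.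
              free_presentation S G \<rho> L \<longrightarrow> schur_multiplier G S \<cong>\<^sub>g H2 L)"
proof (intro conjI allI impI)
  have F: "presentation F L \<pi> R" using assms(3) by unfold_locales
  show "H2 L \<cong>\<^sub>g quotient_space (scale F) (part F)
      (comm_space F UNIV UNIV \<inter> R) (comm_space F UNIV R)"
    by (rule presentation.H2_iso_quotient [OF F assms(4)])
  fix G :: "('k, 'g) superalgebra" and \<rho> S
  assume "free_presentation S G \<rho> L"
  then interpret g: presentation G L \<rho> S by unfold_locales
  \<comment> \<open>Finiteness is carried over from \<open>F\<close>, so the isomorphism is obtained
    from \<open>G\<close> directly, and the two multipliers are never compared.\<close>
  have "H2 L \<cong>\<^sub>g schur_multiplier G S"
    unfolding schur_multiplier_def g.FR_commute
    by (intro g.H2_iso_quotient finite_dim_quotient_transfer [OF F g.presentation_axioms assms(4)])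
  thus "schur_multiplier G S \<cong>\<^sub>g H2 L"
    by (rule graded_iso_sym)
      (simp_all only: H2_def vector_space.quotient_space_closed
        [OF vector_space_forms g.L.subspace_Z2 g.L.subspace_B2])
qed

end
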